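(* Assume that the linear map $A$ is surjective. Suppose that (P) and (D) admit a strictly complementary pair $z_{\star 0}=(x_{\star 0},y_{\star 0})$, put $s_{\star 0}=c+A^{\top}y_{\star 0}$, and suppose that the face $\mathcal C_{s_{\star 0}}$ of $\mathcal K$ and the face $\mathcal C^*_{x_{\star 0}}$ of $\mathcal K^*$ admit quadratic facial violation (relative to $s_{\star 0}$ and $x_{\star 0}$, respectively). Let $z^k=(x^k,y^k)$, $k\ge 0$, be the iterates of either PDHG (with step size $0<\eta<1/\|A\|_2$) or ADMM (with penalty parameter $\rho>0$). Then there are $r,\tilde r>0$ and $q\in(0,1)$ such that for any initial point $z^0=(x^0,y^0)\in B_r(z_{\star 0})$ and all $k\ge 0$, $$\operatorname{dist}(z^k,\mathcal Z_\star)\le q^k\,\tilde r .$$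
   Context: $\mathbf E,\mathbf F$ are finite-dimensional Euclidean spaces with inner products $\langle\cdot,\cdot\rangle$ and induced norms; $A:\mathbf E\to\mathbf F$ is linear with adjoint $A^\top$ and operator norm $\|A\|_2$; $b\in\mathbf F$, $c\in\mathbf E$; $\mathcal K\subset\mathbf E$ is a closed convex cone and $\mathcal K^*=\{s:\langle s,x\rangle\ge 0\ \forall x\in\mathcal K\}$. (P): $\min\{\langle c,x\rangle : Ax=b,\ x\in\mathcal K\}$. (D): $\max\{-\langle b,y\rangle : c+A^\top y=s,\ s\in\mathcal K^*,\ y\in\mathbf F\}$. $\mathcal X_\star\subset \mathbf E$ and $\mathcal Y_\star\subset\mathbf F$ are the sets of optimal $x$ of (P) and optimal $y$ of (D); $\mathcal Z_\star=\mathcal X_\star\times\mathcal Y_\star$. $\operatorname{dist}$ is Euclidean distance and $B_r(z)$ the closed ball of radius $r$ around $z$. Faces: for $s\in\mathcal K^*$, $\mathcal C_s=\{x\in\mathcal K:\langle s,x\rangle=0\}$; for $x\in\mathcal K$, $\mathcal C^*_x=\{s\in\mathcal K^*:\langle s,x\rangle=0\}$. Strictly complementary pair: a pair $(x_\star,y_\star)$, with $x_\star$ optimal for (P), $y_\star$ optimal for (D), slack $s_\star=c+A^\top y_\star$, $\langle x_\star,s_\star\rangle=0$, $x_\star\in\operatorname{relint}(\mathcal C_{s_\star})$ and $s_\star\in\operatorname{relint}(\mathcal C^*_{x_\star})$. Quadratic facial violation (QFV): for a closed convex cone $\mathcal K$ and $s\in\mathcal K^*$, the face $\mathcal C_s$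 admits QFV relative to $s$ if for every compact set $B$ there is $\kappa>0$ with $\operatorname{dist}^2(x,\mathcal C_s)\le\kappa\langle s,x\rangle$ for all $x\in B\cap\mathcal K$. (For $\mathcal C_x^*$, use the same definition with $\mathcal K^*$ in place of $\mathcal K$.) Let $f(x)=\langle c,x\rangle+\iota_{\mathcal K}(x)$ and $g(u)=\iota_{\{b\}}(u)$ (indicator functions), with convex conjugates $f^*,g^*$ (so $g^*(y)=\langle b,y\rangle$), and $\operatorname{prox}_{h}(w)=\arg\min_u\{h(u)+\frac12\|u-w\|^2\}$. PDHG: $x^{k+1}=\operatorname{prox}_{\eta f}(x^k-\eta A^\top y^k)$, $y^{k+1}=\operatorname{prox}_{\eta g^*}(y^k+\eta A(2x^{k+1}-x^k))$. ADMM: $v^{k+1}=\arg\min_v\{f^*(v)-\langle x^k,v\rangle+\frac\rho2\|v+A^\top y^k\|^2\}$, $x^{k+1}=x^k-\rho(v^{k+1}+A^\top y^k)$, $y^{k+1}=\arg\min_u\{g^*(u)-\langle Ax^{k+1},u\rangle+\frac\rho2\|v^{k+1}+A^\top u\|^2\}$. *)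

theory Defs
  imports "HOL-Analysis.Analysis"
begin

section \<open>Cones, faces and quadratic facial violation\<close>

definition dual_cone :: "'a::real_inner set \<Rightarrow> 'a set" where
  "dual_cone K = {s. \<forall>x\<in>K. 0 \<le> s \<bullet> x}"

text \<open>Both kinds of faces are instances: \<open>C\<^sub>s\<close> is \<open>cone_face K s\<close>, and
  \<open>C\<^sup>*\<^sub>x\<close> is \<open>cone_face (dual_cone K) x\<close>.\<close>

definition cone_face :: "'a::real_inner set \<Rightarrow> 'a \<Rightarrow> 'a set" where
  "cone_face K s = {x \<in> K. s \<bullet> x = 0}"

text \<open>Meant for a closed convex cone \<open>K\<close> and \<open>s \<in> dual_cone K\<close>. Then \<open>cone_face K s\<close>
  contains \<open>0\<close>, so that \<open>infdist\<close> is the true distance.\<close>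

definition quadratic_facial_violation :: "'a::real_inner set \<Rightarrow> 'a \<Rightarrow> bool" where
  "quadratic_facial_violation K s \<longleftrightarrow>
     (\<forall>B. compact B \<longrightarrow>
        (\<exists>\<kappa>>0. \<forall>x \<in> B \<inter> K. (infdist x (cone_face K s))\<^sup>2 \<le> \<kappa> * (s \<bullet> x)))"

section \<open>The primal-dual pair of conic programs\<close>

definition primal_solutions ::
    "'e::euclidean_space set \<Rightarrow> ('e \<Rightarrow> 'f::euclidean_space) \<Rightarrow> 'f \<Rightarrow> 'e \<Rightarrow> 'e set" where
  "primal_solutions K A b c = {x. is_arg_min (\<lambda>x. c \<bullet> x) (\<lambda>x. A x = b \<and> x \<in> K) x}"

definition dual_solutions ::
    "'e::euclidean_space set \<Rightarrow> ('e \<Rightarrow> 'f::euclidean_space) \<Rightarrow> 'f \<Rightarrow> 'e \<Rightarrow> 'f set" where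
  "dual_solutions K A b c =
     {y. is_arg_max (\<lambda>y. - (b \<bullet> y)) (\<lambda>y. c + adjoint A y \<in> dual_cone K) y}"

definition strictly_complementary_pair ::
    "'e::euclidean_space set \<Rightarrow> ('e \<Rightarrow> 'f::euclidean_space) \<Rightarrow> 'f \<Rightarrow> 'e \<Rightarrow> 'e \<Rightarrow> 'f \<Rightarrow> bool" where
  "strictly_complementary_pair K A b c x y \<longleftrightarrow>
     x \<in> primal_solutions K A b c \<and> y \<in> dual_solutions K A b c \<and>
     (let s = c + adjoint A y in
        x \<bullet> s = 0 \<and>
        x \<in> rel_interior (cone_face K s) \<and>
        s \<in> rel_interior (cone_face (dual_cone K) x))"

section \<open>Extended-valued functions, conjugates and proximal maps\<close>

definition convex_indicator :: "'a set \<Rightarrow> 'a \<Rightarrow> ereal" where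
  "convex_indicator S x = (if x \<in> S then 0 else \<infinity>)"

definition convex_conjugate :: "('a::real_inner \<Rightarrow> ereal) \<Rightarrow> 'a \<Rightarrow> ereal" where
  "convex_conjugate h v = (SUP x. ereal (v \<bullet> x) - h x)"

definition prox :: "('a::real_inner \<Rightarrow> ereal) \<Rightarrow> 'a \<Rightarrow> 'a" where
  "prox h w = arg_min (\<lambda>u. h u + ereal ((norm (u - w))\<^sup>2 / 2)) (\<lambda>_. True)"

definition primal_objective :: "'e::real_inner set \<Rightarrow> 'e \<Rightarrow> 'e \<Rightarrow> ereal" where
  "primal_objective K c x = ereal (c \<bullet> x) + convex_indicator K x"

section \<open>The two algorithms\<close>

definition pdhg_iterates ::
    "'e::euclidean_space set \<Rightarrow> ('e \<Rightarrow> 'f::euclidean_space) \<Rightarrow> 'f \<Rightarrow> 'e \<Rightarrow> real \<Rightarrow>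
     (nat \<Rightarrow> 'e) \<Rightarrow> (nat \<Rightarrow> 'f) \<Rightarrow> bool" where
  "pdhg_iterates K A b c \<eta> x y \<longleftrightarrow>
     (let f = primal_objective K c; g = convex_indicator {b} in
      \<forall>k. x (Suc k) = prox (\<lambda>u. ereal \<eta> * f u) (x k - \<eta> *\<^sub>R adjoint A (y k)) \<and>
          y (Suc k) = prox (\<lambda>u. ereal \<eta> * convex_conjugate g u)
                        (y k + \<eta> *\<^sub>R A (2 *\<^sub>R x (Suc k) - x k)))"

text \<open>The value \<open>v 0\<close> is unused. For \<open>\<rho> > 0\<close> and \<open>K\<close> a closed convex cone the
  minimizer defining \<open>v\<close> is unique, and so is the one defining \<open>y\<close> when \<open>A\<close> is surjective.\<close>

definition admm_iterates ::
    "'e::euclidean_space set \<Rightarrow> ('e \<Rightarrow> 'f::euclidean_space) \<Rightarrow> 'f \<Rightarrow> 'e \<Rightarrow> real \<Rightarrow>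
     (nat \<Rightarrow> 'e) \<Rightarrow> (nat \<Rightarrow> 'e) \<Rightarrow> (nat \<Rightarrow> 'f) \<Rightarrow> bool" where
  "admm_iterates K A b c \<rho> v x y \<longleftrightarrow>
     (let f = primal_objective K c; g = convex_indicator {b} in
      \<forall>k. v (Suc k) = arg_min
              (\<lambda>w. convex_conjugate f w - ereal (x k \<bullet> w)
                 + ereal (\<rho> / 2 * (norm (w + adjoint A (y k)))\<^sup>2)) (\<lambda>_. True) \<and>
          x (Suc k) = x k - \<rho> *\<^sub>R (v (Suc k) + adjoint A (y k)) \<and>
          y (Suc k) = arg_min
              (\<lambda>u. convex_conjugate g u - ereal (A (x (Suc k)) \<bullet> u)
                 + ereal (\<rho> / 2 * (norm (v (Suc k) + adjoint A u))\<^sup>2)) (\<lambda>_. True))"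

end

theory Submission
  imports Defs
begin

text \<open>
  Both algorithms produce a new iterate satisfying the optimality conditions up to a residual
  that is linear in \<open>d = J (z' - z)\<close>. For PDHG, \<open>J\<close> is the identity and distances are measured in
  the step-size metric; for ADMM, \<open>J (x, y) = x - \<rho> A\<^sup>T y\<close>, and the whole next iterate depends
  Lipschitz-continuously on \<open>J z\<close>. Monotonicity of the optimality conditions gives a Fejer inequality
  for \<open>J\<close>, so linear convergence follows from an error bound
  \<open>dist (z, Z) \<le> M |residual|\<close> near the strictly complementary pair.

  For the error bound let \<open>(x', y')\<close> be the projection of \<open>(x, y)\<close> to the solution set and \<open>D\<close> the distance.
  The gap \<open>\<langle>s', x\<rangle> + \<langle>s, x'\<rangle>\<close> is at most \<open>|residual| D\<close>. As \<open>s'\<close> is close to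
  the relative interior point \<open>s\<^sub>0\<close> of its face, \<open>2 s' - s\<^sub>0\<close> still lies in the dual cone,
  so \<open>\<langle>s\<^sub>0, x\<rangle> \<le> 2 \<langle>s', x\<rangle>\<close>; likewise for \<open>x'\<close>. Quadratic facial violation then
  bounds the squared distances to the two faces by a multiple of \<open>|residual| D\<close>, and by linear
  regularity of the intersection of each face with its affine constraint \<open>D\<close> is bounded by a multiple of
  \<open>sqrt (|residual| D) + |residual|\<close>, hence by a multiple of \<open>|residual|\<close>.
\<close>

section \<open>Regularity and Fejer sequences\<close>

text \<open>Project \<open>x\<close> to \<open>p\<close> in \<open>C\<close> and remove the
  constraint error of \<open>p\<close> by a correction \<open>v\<close> parallel to the affine hull
  of \<open>C\<close>. The point \<open>p - v\<close> may leave \<open>C\<close>; mixing in the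
  relative interior point \<open>z0\<close> with weight at most \<open>norm v / \<delta>\<close>
  brings it back, so the whole displacement is linear in \<open>norm v\<close>.\<close>

lemma linear_regularity:
  fixes Q :: "'a::euclidean_space \<Rightarrow> 'b::euclidean_space"
  assumes C: "convex C" "closed C" and Q: "linear Q"
    and z0: "z0 \<in> rel_interior C" and R: "0 \<le> R"
  shows "\<exists>M>0. \<forall>x\<in>cball z0 R.
           infdist x (C \<inter> {z. Q z = Q z0}) \<le> M * (infdist x C + norm (Q x - Q z0))"
proof -
  obtain \<delta> where z0C: "z0 \<in> C" and \<delta>: "\<delta> > 0" and ball: "cball z0 \<delta> \<inter> affine hull C \<subseteq> C"
    using z0 mem_rel_interior_cball by blast
  define V where "V = (\<lambda>x. x - z0) ` (affine hull C)"
  have V: "subspace V"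
    unfolding V_def using z0C by (intro affine_diffs_subspace_subtract) (auto intro: hull_inc)
  \<comment> \<open>Taking the right inverse on \<open>V\<close> rather than on the whole space
    keeps every correction inside the direction space of \<open>C\<close>.\<close>
  obtain h where h: "range h \<subseteq> V" "linear h" "\<And>u. u \<in> Q ` V \<Longrightarrow> Q (h u) = u"
    using linear_exists_right_inverse_on[OF Q V] by auto
  obtain H where H: "H > 0" "\<And>u. norm (h u) \<le> H * norm u"
    using linear_bounded_pos[OF h(2)] by auto
  obtain L where L: "L > 0" "\<And>u. norm (Q u) \<le> L * norm u"
    using linear_bounded_pos[OF Q] by auto
  \<comment> \<open>The factor \<open>2 + R / \<delta>\<close> bounds the displacement from
    \<open>p\<close> to \<open>z\<close> per unit of \<open>norm v\<close>; \<open>H\<close> turns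
    the constraint error of \<open>p\<close> into a bound for \<open>norm v\<close>.\<close>
  define G where "G = (2 + R / \<delta>) * H"
  have G: "0 \<le> G" using R \<delta> H by (simp add: G_def)
  define M where "M = 1 + G * (1 + L)"
  have "infdist x (C \<inter> {z. Q z = Q z0}) \<le> M * (infdist x C + norm (Q x - Q z0))"
    if x: "x \<in> cball z0 R" for x
  proof -
    define p where "p = closest_point C x"
    have Cne: "C \<noteq> {}" using z0C by auto
    have pC: "p \<in> C" unfolding p_def by (rule closest_point_in_set[OF C(2) Cne])
    have d: "infdist x C = dist x p"
    proof (rule antisym)
      show "infdist x C \<le> dist x p" using pC by (rule infdist_le)
      have "\<exists>y\<in>C. infdist x C = dist x y" using infdist_attains_inf[OF C(2) Cne] by blast
      then show "dist x p \<le> infdist x C"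
        unfolding p_def using closest_point_le[OF C(2)] by auto
    qed
    define v where "v = h (Q p - Q z0)"
    have Qv: "Q v = Q p - Q z0"
    proof -
      have "p - z0 \<in> V" unfolding V_def using pC by (auto intro: hull_inc)
      then have "Q (p - z0) \<in> Q ` V" by blast
      then show ?thesis unfolding v_def using h(3) by (simp add: linear_diff[OF Q])
    qed
    have vV: "v \<in> V" using h(1) by (auto simp: v_def)
    have nv: "norm v \<le> H * (norm (Q x - Q z0) + L * dist x p)"
    proof -
      have "norm (Q p - Q z0) \<le> norm (Q x - Q z0) + norm (Q p - Q x)"
        using norm_triangle_ineq[of "Q x - Q z0" "Q p - Q x"] by simp
      also have "norm (Q p - Q x) \<le> L * dist x p"
        using L(2)[of "p - x"] by (simp add: linear_diff[OF Q] dist_norm norm_minus_commute)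
      finally show ?thesis
        unfolding v_def using H by (meson add_left_mono mult_left_mono order_trans less_imp_le)
    qed
    define n where "n = norm v + \<delta>"
    have n: "n > 0" using \<delta> by (simp add: n_def add_nonneg_pos)
    \<comment> \<open>Both \<open>p - v\<close> and \<open>z0\<close> satisfy the constraint, hence
      so does \<open>z\<close>. The weights are such that the \<open>v\<close>-term can be moved
      from \<open>p\<close> to \<open>z0\<close>: then \<open>z\<close> mixes \<open>p\<close> with
      a point at distance \<open>\<delta>\<close> from \<open>z0\<close> in the affine hull, and
      both lie in \<open>C\<close>.\<close>
    define z where "z = (\<delta> / n) *\<^sub>R (p - v) + (norm v / n) *\<^sub>R z0"
    have sum1: "\<delta> / n + norm v / n = 1" using n by (simp add: n_def add_divide_distrib[symmetric] add.commute)
    have zC: "z \<in> C"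
    proof (cases "v = 0")
      case True
      then show ?thesis using pC \<delta> by (simp add: z_def n_def)
    next
      case False
      define w where "w = z0 - (\<delta> / norm v) *\<^sub>R v"
      have "(- (\<delta> / norm v)) *\<^sub>R v \<in> V" using V vV by (rule subspace_scale)
      then have "w \<in> affine hull C" unfolding V_def w_def by (auto simp: algebra_simps)
      moreover have "dist z0 w = \<delta>" using False \<delta> by (simp add: w_def dist_norm)
      ultimately have wC: "w \<in> C" using ball by auto
      have "z = (\<delta> / n) *\<^sub>R p + (norm v / n) *\<^sub>R w"
        unfolding z_def w_def using False by (simp add: algebra_simps)
      then show ?thesis
        using convexD[OF C(1) pC wC _ _ sum1] \<delta> n by simp
    qed
    have Qz: "Q z = Q z0"
    proof -
      have "Q z = (\<delta> / n) *\<^sub>R Q z0 + (norm v / n) *\<^sub>R Q z0"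
        by (simp add: z_def linear_add[OF Q] linear_cmul[OF Q] linear_diff[OF Q] Qv)
      also have "\<dots> = Q z0" unfolding scaleR_left_distrib[symmetric] sum1 by simp
      finally show ?thesis .
    qed
    have pz: "dist z0 p \<le> R"
      using closest_point_lipschitz[OF C Cne, of z0 x] closest_point_self[OF z0C] x
      by (simp add: p_def)
    have "dist x z \<le> dist x p + norm v * (2 + R / \<delta>)"
    proof -
      have t1: "norm v / n \<le> 1" and t2: "norm v / n \<le> norm v / \<delta>"
        using n \<delta> by (auto simp: n_def frac_le)
      have dn: "\<delta> / n = 1 - norm v / n" using sum1 by linarith
      have "z = p - v + (norm v / n) *\<^sub>R (z0 - p + v)"
        unfolding z_def dn by (simp add: algebra_simps)
      then have "x - z = (x - p) + v - (norm v / n) *\<^sub>R (z0 - p) - (norm v / n) *\<^sub>R v"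
        by (simp add: algebra_simps)
      moreover have "norm (a + b - c - d) \<le> norm a + norm b + norm c + norm d" for a b c d :: 'a
        by norm
      ultimately have "dist x z \<le> dist x p + norm v + norm ((norm v / n) *\<^sub>R (z0 - p)) + norm ((norm v / n) *\<^sub>R v)"
        unfolding dist_norm by (metis (no_types))
      moreover have "norm ((norm v / n) *\<^sub>R (z0 - p)) \<le> norm v / \<delta> * R"
      proof -
        have "norm v / n * norm (z0 - p) \<le> norm v / \<delta> * R"
          using pz t2 \<delta> by (intro mult_mono) (auto simp: dist_norm)
        then show ?thesis using n by simp
      qed
      moreover have "norm ((norm v / n) *\<^sub>R v) \<le> norm v"
        using t1 n mult_right_mono[OF t1, of "norm v"] by simp
      ultimately show ?thesis by (simp add: algebra_simps)
    qed
    also have "\<dots> \<le> dist x p + H * (norm (Q x - Q z0) + L * dist x p) * (2 + R / \<delta>)"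
      using nv R \<delta> by (intro add_left_mono mult_right_mono) auto
    also have "\<dots> = dist x p + G * norm (Q x - Q z0) + G * L * dist x p"
      by (simp add: G_def algebra_simps)
    also have "\<dots> \<le> M * (dist x p + norm (Q x - Q z0))"
    proof -
      have "0 \<le> G * dist x p" "0 \<le> norm (Q x - Q z0)" "0 \<le> G * L * norm (Q x - Q z0)"
        using G L by simp_all
      then show ?thesis unfolding M_def by (simp add: algebra_simps)
    qed
    finally have "dist x z \<le> M * (dist x p + norm (Q x - Q z0))" .
    moreover have "infdist x (C \<inter> {z. Q z = Q z0}) \<le> dist x z"
      using zC Qz by (intro infdist_le) auto
    ultimately show ?thesis using d by simp
  qed
  moreover have "M > 0" using G L by (simp add: M_def add_pos_nonneg)
  ultimately show ?thesis by blast
qed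

text \<open>The extrapolated point stays in the affine hull, at twice the distance of
  \<open>t\<close> from \<open>z\<close>, so half the radius of a relative ball suffices. It lets a
  fixed relative interior point be compared with any nearby point of the face.\<close>

lemma rel_interior_extrapolate:
  fixes z :: "'a::euclidean_space"
  assumes "z \<in> rel_interior S"
  shows "\<exists>\<delta>>0. \<forall>t\<in>S. dist t z \<le> \<delta> \<longrightarrow> 2 *\<^sub>R t - z \<in> S"
proof -
  obtain e where zS: "z \<in> S" and e: "e > 0" and ball: "cball z e \<inter> affine hull S \<subseteq> S"
    using assms mem_rel_interior_cball by blast
  have "2 *\<^sub>R t - z \<in> S" if "t \<in> S" "dist t z \<le> e / 2" for t
  proof -
    have "2 *\<^sub>R t + (- 1) *\<^sub>R z \<in> affine hull S"
      using that zS by (intro mem_affine[OF affine_affine_hull]) (auto intro: hull_inc)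
    moreover have "dist z (2 *\<^sub>R t - z) = 2 * dist t z"
    proof -
      have "z - (2 *\<^sub>R t - z) = 2 *\<^sub>R (z - t)" by (simp add: algebra_simps scaleR_2)
      then have "norm (z - (2 *\<^sub>R t - z)) = 2 * norm (z - t)" by (metis norm_scaleR abs_numeral)
      then show ?thesis by (metis dist_norm dist_commute)
    qed
    ultimately show ?thesis using ball that by auto
  qed
  then show ?thesis using e by (intro exI[of _ "e/2"]) auto
qed

text \<open>Let \<open>e\<close> be the squared distance to \<open>Z\<close> measured by
  \<open>N\<close>. Each step lowers \<open>e\<close> by at least \<open>N (z' - z)\<close>, and the
  error bound gives \<open>e z' \<le> \<alpha> * \<gamma> * N (z' - z)\<close>; eliminating the step
  yields a contraction of \<open>e\<close>. Since \<open>N\<close> may vanish on nonzero vectors,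
  \<open>lip\<close> is what returns from \<open>e\<close> to true distances, one iterate
  later.\<close>

lemma fejer_linear_convergence:
  fixes Z :: "'a::real_normed_vector set" and N :: "'a \<Rightarrow> real"
  assumes p: "p \<in> Z" and pos: "R > 0" "\<alpha> > 0" "\<beta> > 0" "\<gamma> > 0"
    and N: "\<And>d. 0 \<le> N d" "\<And>d. N d \<le> \<alpha> * (norm d)\<^sup>2"
    and fejer: "\<And>z z' w. T z z' \<Longrightarrow> w \<in> Z \<Longrightarrow> N (z' - w) + N (z' - z) \<le> N (z - w)"
    and lip: "\<And>z z' w. T z z' \<Longrightarrow> w \<in> Z \<Longrightarrow> (norm (z' - w))\<^sup>2 \<le> \<beta> * N (z - w)"
    and eb: "\<And>z z'. T z z' \<Longrightarrow> dist z' p \<le> R \<Longrightarrow> (infdist z' Z)\<^sup>2 \<le> \<gamma> * N (z' - z)"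
  shows "\<exists>r>0. \<exists>r'>0. \<exists>q. 0 < q \<and> q < 1 \<and>
    (\<forall>z. (\<forall>k. T (z k) (z (Suc k))) \<and> z 0 \<in> cball p r \<longrightarrow>
         (\<forall>k. infdist (z k) Z \<le> q ^ k * r'))"
proof -
  define e where "e z = (INF w\<in>Z. N (z - w))" for z
  have Zne: "Z \<noteq> {}" using p by auto
  have bdd: "bdd_below ((\<lambda>w. N (z - w)) ` Z)" for z using N(1) by (auto intro: bdd_belowI[of _ 0])
  have e_le: "e z \<le> N (z - w)" if "w \<in> Z" for z w
    unfolding e_def using bdd that by (rule cINF_lower)
  have e_ge: "a \<le> e z" if "\<And>w. w \<in> Z \<Longrightarrow> a \<le> N (z - w)" for a z
    unfolding e_def using Zne that by (rule cINF_greatest)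
  have e0: "0 \<le> e z" for z using N(1) by (intro e_ge)
  have e_dec: "e z' + N (z' - z) \<le> e z" if "T z z'" for z z'
    using fejer[OF that] e_le[of _ z'] by (intro e_ge) force
  have e_lip: "(infdist z' Z)\<^sup>2 \<le> \<beta> * e z" if "T z z'" for z z'
  proof -
    have "(infdist z' Z)\<^sup>2 / \<beta> \<le> e z"
    proof (rule e_ge)
      fix w assume w: "w \<in> Z"
      have "(infdist z' Z)\<^sup>2 \<le> (norm (z' - w))\<^sup>2"
        using infdist_le[OF w, of z'] by (simp add: dist_norm infdist_nonneg power_mono)
      then show "(infdist z' Z)\<^sup>2 / \<beta> \<le> N (z - w)"
        using lip[OF that w] pos by (simp add: field_simps)
    qed
    then show ?thesis using pos by (simp add: field_simps)
  qed
  have e_inf: "e z \<le> \<alpha> * (infdist z Z)\<^sup>2" for z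
  proof -
    have "sqrt (e z / \<alpha>) \<le> infdist z Z"
      unfolding infdist_notempty[OF Zne]
    proof (rule cINF_greatest[OF Zne])
      fix w assume "w \<in> Z"
      then have "e z / \<alpha> \<le> (norm (z - w))\<^sup>2"
        using order_trans[OF e_le N(2)] pos by (simp add: field_simps)
      then show "sqrt (e z / \<alpha>) \<le> dist z w"
        unfolding dist_norm by (simp add: real_le_lsqrt)
    qed
    then have "(sqrt (e z / \<alpha>))\<^sup>2 \<le> (infdist z Z)\<^sup>2"
      using e0 pos by (intro power_mono) auto
    then show ?thesis using e0[of z] pos by (simp add: field_simps)
  qed
  \<comment> \<open>With this \<open>r\<close>,
    \<open>\<beta> * \<alpha> * r\<^sup>2 = R\<^sup>2\<close>, so \<open>lip\<close> keeps all
    iterates after the initial one where the error bound applies. In \<open>r'\<close> the first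
    summand serves \<open>k = 0\<close>, the second all later \<open>k\<close>; its division by
    \<open>q\<close> pays for the index that \<open>lip\<close> loses.\<close>
  define r where "r = R / sqrt (\<alpha> * \<beta>)"
  define q where "q = sqrt (\<alpha> * \<gamma> / (1 + \<alpha> * \<gamma>))"
  define r' where "r' = r + sqrt (\<alpha> * \<beta>) * r / q"
  have c13: "\<alpha> * \<gamma> > 0" and c12: "sqrt (\<alpha> * \<beta>) > 0" using pos by auto
  have r: "r > 0" using c12 pos by (simp add: r_def)
  have q: "0 < q" "q < 1" and q2: "q\<^sup>2 = \<alpha> * \<gamma> / (1 + \<alpha> * \<gamma>)"
    using c13 by (auto simp: q_def)
  have r': "r' > 0" using r q c12 by (simp add: r'_def add_pos_nonneg)
  have main: "infdist (z k) Z \<le> q ^ k * r'"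
    if T: "\<forall>k. T (z k) (z (Suc k))" and init: "z 0 \<in> cball p r" for z k
  proof -
    have N0: "N (z 0 - p) \<le> \<alpha> * r\<^sup>2"
    proof -
      have "norm (z 0 - p) \<le> r" using init by (simp add: dist_norm norm_minus_commute)
      then have "\<alpha> * (norm (z 0 - p))\<^sup>2 \<le> \<alpha> * r\<^sup>2"
        using pos by (intro mult_left_mono power_mono) auto
      then show ?thesis using N(2)[of "z 0 - p"] by linarith
    qed
    have Nk: "N (z k - p) \<le> \<alpha> * r\<^sup>2" for k
    proof (induction k)
      case (Suc k)
      then show ?case using fejer[OF T[rule_format, of k] p] N(1)[of "z (Suc k) - z k"] by linarith
    qed (rule N0)
    have near: "dist (z (Suc k)) p \<le> R" for k
    proof -
      have "(dist (z (Suc k)) p)\<^sup>2 \<le> \<beta> * (\<alpha> * r\<^sup>2)"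
        using lip[OF T[rule_format, of k] p] Nk[of k] pos
        by (simp add: dist_norm) (meson mult_le_cancel_left_pos order_trans)
      also have "\<dots> = R\<^sup>2" using pos by (simp add: r_def power_divide)
      finally show ?thesis by (rule power2_le_imp_le) (use pos in simp)
    qed
    have contr: "e (z (Suc k)) \<le> q\<^sup>2 * e (z k)" for k
    proof -
      let ?E = "e (z (Suc k))" and ?n = "N (z (Suc k) - z k)"
      have "?E \<le> \<alpha> * (\<gamma> * ?n)"
        using e_inf[of "z (Suc k)"] eb[OF T[rule_format] near, of k] pos
        by (meson mult_le_cancel_left_pos order_trans)
      moreover have "\<alpha> * \<gamma> * (?E + ?n) \<le> \<alpha> * \<gamma> * e (z k)"
        using e_dec[OF T[rule_format, of k]] c13 by (intro mult_left_mono) auto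
      ultimately have "(1 + \<alpha> * \<gamma>) * ?E \<le> \<alpha> * \<gamma> * e (z k)" by (simp add: algebra_simps)
      then show ?thesis unfolding q2 using c13 by (simp add: field_simps)
    qed
    have ek: "e (z k) \<le> (q ^ k)\<^sup>2 * (\<alpha> * r\<^sup>2)" for k
    proof (induction k)
      case 0
      then show ?case using order_trans[OF e_le[OF p] N0] by simp
    next
      case (Suc k)
      have "e (z (Suc k)) \<le> q\<^sup>2 * ((q ^ k)\<^sup>2 * (\<alpha> * r\<^sup>2))"
        using contr[of k] Suc mult_left_mono[OF Suc, of "q\<^sup>2"] by simp
      then show ?case by (simp add: power_mult_distrib mult.assoc)
    qed
    show ?thesis
    proof (cases k)
      case 0
      have "infdist (z 0) Z \<le> dist (z 0) p" using p by (rule infdist_le)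
      also have "\<dots> \<le> r" using init by (simp add: dist_commute)
      also have "\<dots> \<le> r'" unfolding r'_def using r q c12 by simp
      finally show ?thesis using 0 by simp
    next
      case (Suc j)
      have "(infdist (z k) Z)\<^sup>2 \<le> \<beta> * ((q ^ j)\<^sup>2 * (\<alpha> * r\<^sup>2))"
        using e_lip[OF T[rule_format, of j]] ek[of j] pos Suc
        by simp (meson mult_le_cancel_left_pos order_trans)
      also have "\<dots> = (q ^ j * (sqrt (\<alpha> * \<beta>) * r))\<^sup>2" using pos by (simp add: power_mult_distrib)
      finally have "infdist (z k) Z \<le> q ^ j * (sqrt (\<alpha> * \<beta>) * r)"
        by (rule power2_le_imp_le) (use q r c12 in simp)
      also have "\<dots> = q ^ k * (sqrt (\<alpha> * \<beta>) * r / q)" using q Suc by simp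
      also have "\<dots> \<le> q ^ k * r'" unfolding r'_def using q r by (intro mult_left_mono) auto
      finally show ?thesis .
    qed
  qed
  show ?thesis using r r' q main by (intro exI[of _ r] exI[of _ r'] exI[of _ q] conjI) auto
qed

section \<open>Convex cones\<close>

lemma closed_dual_cone: "closed (dual_cone K)"
proof -
  have "dual_cone K = (\<Inter>x\<in>K. {s. 0 \<le> x \<bullet> s})" by (auto simp: dual_cone_def inner_commute)
  then show ?thesis by (auto intro!: closed_halfspace_ge)
qed

lemma convex_cone_dual_cone: "convex_cone (dual_cone K)"
  unfolding convex_cone_iff dual_cone_def by (auto simp: inner_left_distrib)

text \<open>Testing with \<open>p + x\<close> for \<open>x\<close> in the cone gives dual
  membership; testing with \<open>2 *\<^sub>R p\<close> and \<open>0\<close> gives both signs of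
  \<open>g \<bullet> p\<close>.\<close>

lemma convex_cone_variational_inequality:
  assumes K: "convex_cone K" and p: "p \<in> K" and ge: "\<And>x. x \<in> K \<Longrightarrow> 0 \<le> g \<bullet> (x - p)"
  shows "g \<in> dual_cone K" "g \<bullet> p = 0"
proof -
  have "0 \<le> g \<bullet> x" if "x \<in> K" for x
    using ge[OF convex_cone_add[OF K that p]] by simp
  then show "g \<in> dual_cone K" by (simp add: dual_cone_def)
  show "g \<bullet> p = 0"
    using ge[OF convex_cone_scaleR[OF K _ p, of 2]] ge[OF convex_cone_contains_0[OF K]]
    by (simp add: scaleR_2)
qed

text \<open>Moreau decomposition: the variational inequality of the projection, read on a
  cone.\<close>

lemma closest_point_convex_cone:
  fixes K :: "'a::euclidean_space set"
  assumes "closed K" "convex_cone K"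
  shows "closest_point K w \<in> K" "closest_point K w - w \<in> dual_cone K"
    "(closest_point K w - w) \<bullet> closest_point K w = 0"
proof -
  show p: "closest_point K w \<in> K"
    using assms by (intro closest_point_in_set) (auto simp: convex_cone_def)
  have conv: "convex K" using assms(2) by (simp add: convex_cone_def)
  have "0 \<le> (closest_point K w - w) \<bullet> (x - closest_point K w)" if "x \<in> K" for x
    using closest_point_dot[OF conv assms(1) that, of w]
    by (metis inner_minus_left minus_diff_eq neg_le_0_iff_le)
  from convex_cone_variational_inequality[OF assms(2) p this]
  show "closest_point K w - w \<in> dual_cone K" "(closest_point K w - w) \<bullet> closest_point K w = 0"
    by auto
qed

text \<open>Bipolar theorem: with \<open>p\<close> the projection of \<open>x\<close>, the dual
  vector \<open>p - x\<close> is orthogonal to \<open>p\<close> and has nonnegative product with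
  \<open>x\<close>, which forces \<open>p = x\<close>.\<close>

lemma dual_dual_cone_subset:
  fixes K :: "'a::euclidean_space set"
  assumes "closed K" "convex_cone K"
  shows "dual_cone (dual_cone K) \<subseteq> K"
proof
  fix x assume x: "x \<in> dual_cone (dual_cone K)"
  let ?p = "closest_point K x"
  have p: "?p \<in> K" using assms by (rule closest_point_convex_cone)
  have "0 \<le> (?p - x) \<bullet> x"
    using x closest_point_convex_cone(2)[OF assms, of x] 
    unfolding dual_cone_def[of "dual_cone K"] by (metis (no_types, lifting) inner_commute mem_Collect_eq)
  then have "(?p - x) \<bullet> (?p - x) \<le> 0"
    using closest_point_convex_cone(3)[OF assms, of x] by (simp add: inner_diff_right)
  then have "?p = x" by (metis dual_order.antisym eq_iff_diff_eq_0 inner_eq_zero_iff inner_ge_zero)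
  then show "x \<in> K" using p by simp
qed

lemma closed_convex_cone_face:
  assumes "closed K" "convex_cone K"
  shows "closed (cone_face K s)" "convex (cone_face K s)"
proof -
  have "cone_face K s = K \<inter> {x. s \<bullet> x = 0}" by (auto simp: cone_face_def)
  then show "closed (cone_face K s)" "convex (cone_face K s)"
    using assms by (auto intro!: closed_Int convex_Int closed_hyperplane convex_hyperplane
        simp: convex_cone_def)
qed

section \<open>The error bound\<close>

locale complementary_conic_program =
  fixes K :: "'e::euclidean_space set"
    and A :: "'e \<Rightarrow> 'f::euclidean_space"
    and b :: 'f and c :: 'e
    and xs :: 'e and ys :: 'f
  assumes closed_K: "closed K" and cone_K: "convex_cone K"
    and lin_A: "linear A" and surj_A: "surj A"
    and complementary: "strictly_complementary_pair K A b c xs ys"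
begin

definition ss :: 'e where "ss = c + adjoint A ys"
definition Z :: "('e \<times> 'f) set" where
  "Z = primal_solutions K A b c \<times> dual_solutions K A b c"

lemma lin_At: "linear (adjoint A)"
  using lin_A by (rule adjoint_linear)

lemma adj: "x \<bullet> adjoint A y = A x \<bullet> y" "adjoint A y \<bullet> x = y \<bullet> A x"
  using adjoint_works[OF lin_A] by (auto simp: inner_commute)

lemma xs: "xs \<in> K" "A xs = b" "xs \<in> rel_interior (cone_face K ss)"
  and ss: "ss \<in> dual_cone K" "ss \<in> rel_interior (cone_face (dual_cone K) xs)"
  and xs_ss: "xs \<bullet> ss = 0"
  using complementary
  by (auto simp: strictly_complementary_pair_def Let_def ss_def primal_solutions_def
      dual_solutions_def is_arg_min_def is_arg_max_def)

text \<open>When \<open>A x = b\<close>, the objective \<open>c \<bullet> x\<close> differs from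
  \<open>ss \<bullet> x\<close> by a constant, and the latter is nonnegative on \<open>K\<close> and
  vanishes at \<open>xs\<close>.\<close>

lemma primal_solutions_eq: "primal_solutions K A b c = {x \<in> cone_face K ss. A x = b}"
proof -
  have c: "c \<bullet> x = ss \<bullet> x - ys \<bullet> b" if "A x = b" for x
    using that by (simp add: ss_def inner_add_left adj)
  have "ss \<bullet> x = 0" if "x \<in> primal_solutions K A b c" for x
  proof -
    have x: "A x = b" "c \<bullet> x \<le> c \<bullet> xs"
      using that xs by (auto simp: primal_solutions_def is_arg_min_linorder)
    moreover have "x \<in> K" using that by (auto simp: primal_solutions_def is_arg_min_def)
    ultimately show ?thesis
      using c[of x] c[of xs] xs xs_ss ss by (auto simp: dual_cone_def inner_commute intro: antisym)
  qed
  moreover have "x \<in> primal_solutions K A b c" if "x \<in> K" "A x = b" "ss \<bullet> x = 0" for x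
    unfolding primal_solutions_def is_arg_min_linorder
    using that c ss by (auto simp: dual_cone_def)
  ultimately show ?thesis
    by (auto simp: cone_face_def) (auto simp: primal_solutions_def is_arg_min_def)
qed

text \<open>Since \<open>A xs = b\<close>, the dual objective is a constant minus the product of
  \<open>xs\<close> with the slack; that product is nonnegative and vanishes at
  \<open>ys\<close>.\<close>

lemma dual_solutions_eq:
  "dual_solutions K A b c = {y. c + adjoint A y \<in> cone_face (dual_cone K) xs}"
proof -
  have b: "b \<bullet> y = xs \<bullet> (c + adjoint A y) - xs \<bullet> c" for y
    using xs by (simp add: inner_add_right adj)
  have ge: "0 \<le> xs \<bullet> s" if "s \<in> dual_cone K" for s
    using that xs by (auto simp: dual_cone_def inner_commute)
  have "xs \<bullet> (c + adjoint A y) = 0" if "y \<in> dual_solutions K A b c" for y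
  proof -
    have "- (b \<bullet> ys) \<le> - (b \<bullet> y)" "c + adjoint A y \<in> dual_cone K"
      using that ss by (auto simp: dual_solutions_def is_arg_max_linorder ss_def)
    then show ?thesis using b[of y] b[of ys] ge xs_ss by (auto simp: ss_def intro: antisym)
  qed
  moreover have "y \<in> dual_solutions K A b c"
    if "c + adjoint A y \<in> dual_cone K" "xs \<bullet> (c + adjoint A y) = 0" for y
    unfolding dual_solutions_def is_arg_max_linorder using that b ge by auto
  ultimately show ?thesis
    by (auto simp: cone_face_def) (auto simp: dual_solutions_def is_arg_max_def)
qed

lemma ZD:
  assumes "(x, y) \<in> Z"
  shows "x \<in> cone_face K ss" "x \<in> K" "A x = b" "c + adjoint A y \<in> cone_face (dual_cone K) xs"
    "c + adjoint A y \<in> dual_cone K" "x \<bullet> (c + adjoint A y) = 0"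
proof -
  show 1: "x \<in> cone_face K ss" "x \<in> K" "A x = b" "c + adjoint A y \<in> cone_face (dual_cone K) xs"
    "c + adjoint A y \<in> dual_cone K"
    using assms by (auto simp: Z_def primal_solutions_eq dual_solutions_eq cone_face_def)
  \<comment> \<open>Complementarity carries over from the given pair to mixed pairs, and hence to
    any two solutions, because all the products share the same optimal values.\<close>
  have "ss \<bullet> x = 0" "xs \<bullet> (c + adjoint A y) = 0" using 1 by (auto simp: cone_face_def)
  then show "x \<bullet> (c + adjoint A y) = 0"
    using 1 xs xs_ss by (auto simp: ss_def inner_add_left inner_add_right adj inner_commute)
qed

lemma pair_in_Z: "(xs, ys) \<in> Z"
  using complementary by (simp add: Z_def strictly_complementary_pair_def)

lemma closed_primal_solutions: "closed (primal_solutions K A b c)"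
proof -
  have "primal_solutions K A b c = cone_face K ss \<inter> (A -` {b})"
    by (auto simp: primal_solutions_eq)
  then show ?thesis
    using closed_convex_cone_face(1)[OF closed_K cone_K, of ss] lin_A
    by (auto intro!: closed_Int continuous_closed_vimage linear_continuous_at
        simp: linear_conv_bounded_linear)
qed

lemma closed_dual_solutions: "closed (dual_solutions K A b c)"
proof -
  have "dual_solutions K A b c = (\<lambda>y. c + adjoint A y) -` cone_face (dual_cone K) xs"
    by (auto simp: dual_solutions_eq)
  moreover have "isCont (\<lambda>y. c + adjoint A y) y" for y
    using lin_At by (intro continuous_add continuous_const linear_continuous_at)
      (simp add: linear_conv_bounded_linear)
  ultimately show ?thesis
    using closed_convex_cone_face(1)[OF closed_dual_cone convex_cone_dual_cone, of K xs]
    by (simp add: continuous_closed_vimage)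
qed

text \<open>Surjectivity of \<open>A\<close> makes its adjoint injective; the left inverse recovers
  dual variables from slacks with a Lipschitz constant.\<close>

lemma adjoint_left_inverse:
  obtains g G where "linear g" "\<And>y. g (adjoint A y) = y" "G > 0" "\<And>u. norm (g u) \<le> G * norm u"
proof -
  have "inj (adjoint A)" using surj_A lin_A by simp
  then obtain g where g: "linear g" "g \<circ> adjoint A = id"
    using linear_injective_left_inverse[OF lin_At] by blast
  then obtain G where "G > 0" "\<And>u. norm (g u) \<le> G * norm u"
    using linear_bounded_pos by blast
  then show ?thesis using that g by (metis comp_apply id_apply)
qed

text \<open>With \<open>s' = c + adjoint A y'\<close>, the products \<open>s \<bullet> x\<close> and
  \<open>s' \<bullet> x'\<close> vanish, so the gap equals
  \<open>(s' - s) \<bullet> (x - x')\<close>. Inserting \<open>adjoint A y\<close> splits it into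
  the dual and the primal residual.\<close>

lemma duality_gap:
  assumes "s \<bullet> x = 0" "(x', y') \<in> Z"
  shows "(c + adjoint A y') \<bullet> x + s \<bullet> x'
    = (c + adjoint A y - s) \<bullet> (x - x') - (y - y') \<bullet> (A x - b)"
  using assms(1) ZD[OF assms(2)]
  by (simp add: inner_add_left inner_diff_left inner_diff_right inner_add_right adj linear_diff[OF lin_A]
      inner_commute)

lemma monotone:
  assumes "x \<in> K" "s \<in> dual_cone K" "s \<bullet> x = 0" "(x', y') \<in> Z"
  shows "(y - y') \<bullet> (A x - b) \<le> (c + adjoint A y - s) \<bullet> (x - x')"
proof -
  have "0 \<le> (c + adjoint A y') \<bullet> x" "0 \<le> s \<bullet> x'"
    using assms ZD[OF assms(4)] by (auto simp: dual_cone_def)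
  then show ?thesis using duality_gap[OF assms(3,4), of y] by linarith
qed

lemma primal_regularity:
  assumes "0 \<le> R"
  obtains M where "M > 0" "\<And>x. dist xs x \<le> R \<Longrightarrow>
    infdist x (primal_solutions K A b c) \<le> M * (infdist x (cone_face K ss) + norm (A x - b))"
proof -
  have "primal_solutions K A b c = cone_face K ss \<inter> {x. A x = A xs}"
    using xs by (auto simp: primal_solutions_eq)
  then show ?thesis
    using linear_regularity[OF closed_convex_cone_face(2,1)[OF closed_K cone_K] lin_A xs(3) assms]
      xs(2) that by auto
qed

text \<open>Regularity is applied in slack space. The map \<open>Q\<close>, defined by
  \<open>Q s = s - adjoint A (g s)\<close>, vanishes exactly on the range of the adjoint, so the
  slack condition becomes the linear constraint \<open>Q s = Q ss\<close>; the left inverse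
  \<open>g\<close> carries the nearby slack back to a dual solution.\<close>

lemma dual_regularity:
  assumes "0 \<le> R"
  obtains M where "M > 0" "\<And>y. dist ys y \<le> R \<Longrightarrow>
    infdist y (dual_solutions K A b c)
      \<le> M * infdist (c + adjoint A y) (cone_face (dual_cone K) xs)"
proof -
  let ?F = "cone_face (dual_cone K) xs"
  obtain g G where g: "linear g" "\<And>y. g (adjoint A y) = y" and
    G: "G > 0" "\<And>u. norm (g u) \<le> G * norm u" using adjoint_left_inverse by metis
  obtain L where L: "L > 0" "\<And>u. norm (adjoint A u) \<le> L * norm u"
    using linear_bounded_pos[OF lin_At] by auto
  define Q where "Q s = s - adjoint A (g s)" for s
  have Q: "linear Q"
    unfolding Q_def
    using linear_compose_sub[OF linear_ident linear_compose[OF g(1) lin_At]] by (simp add: o_def)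
  have QA: "Q (c + adjoint A y) = Q c" for y
    unfolding Q_def by (simp add: linear_add[OF g(1)] g(2) linear_add[OF lin_At])
  have F: "closed ?F" "convex ?F"
    using closed_convex_cone_face[OF closed_dual_cone convex_cone_dual_cone] by blast+
  obtain M where M: "M > 0" and reg: "\<And>s. s \<in> cball ss (L * R) \<Longrightarrow>
      infdist s (?F \<inter> {z. Q z = Q ss}) \<le> M * (infdist s ?F + norm (Q s - Q ss))"
    using linear_regularity[OF F(2,1) Q ss(2), of "L * R"] L assms by auto
  have "infdist y (dual_solutions K A b c) \<le> (G * M) * infdist (c + adjoint A y) ?F"
    if y: "dist ys y \<le> R" for y
  proof -
    let ?s = "c + adjoint A y" and ?S = "?F \<inter> {z. Q z = Q ss}"
    have "norm (adjoint A (ys - y)) \<le> L * R"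
      using L(2)[of "ys - y"] y L(1)
      by (metis dist_norm mult_le_cancel_left_pos order_trans)
    then have "?s \<in> cball ss (L * R)"
      by (simp add: ss_def dist_norm linear_diff[OF lin_At])
    from reg[OF this] have 1: "infdist ?s ?S \<le> M * infdist ?s ?F"
      by (simp add: ss_def QA)
    have "closed ?S"
    proof -
      have "?S = ?F \<inter> Q -` {Q ss}" by auto
      then show ?thesis
        using F Q by (auto intro!: closed_Int continuous_closed_vimage linear_continuous_at
            simp: linear_conv_bounded_linear)
    qed
    moreover have "ss \<in> ?S" using ss(2) rel_interior_subset by auto
    ultimately obtain s' where s': "s' \<in> ?S" "infdist ?s ?S = dist ?s s'"
      using infdist_attains_inf[of ?S ?s] by blast
    define y' where "y' = g (s' - c)"
    have "Q (s' - c) = 0" using s'(1) by (simp add: linear_diff[OF Q] ss_def QA)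
    then have "adjoint A y' = s' - c" by (simp add: y'_def Q_def)
    then have "y' \<in> dual_solutions K A b c"
      using s' by (simp add: dual_solutions_eq)
    then have "infdist y (dual_solutions K A b c) \<le> dist y y'" by (rule infdist_le)
    also have "\<dots> = norm (g (?s - s'))"
      by (simp add: y'_def linear_diff[OF g(1)] linear_add[OF g(1)] g(2) dist_norm algebra_simps)
    also have "\<dots> \<le> G * dist ?s s'" using G(2) by (simp add: dist_norm)
    also have "\<dots> \<le> G * (M * infdist ?s ?F)" using 1 s' G by simp
    finally show ?thesis by simp
  qed
  then show ?thesis using that[of "G * M"] G M by simp
qed

end

lemma infdist_Times_le:
  fixes X :: "'a::heine_borel set" and Y :: "'b::heine_borel set"
  assumes "closed X" "closed Y"
  shows "infdist (x, y) (X \<times> Y) \<le> infdist x X + infdist y Y"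
proof (cases "X = {} \<or> Y = {}")
  case True
  then have "infdist (x, y) (X \<times> Y) = 0" by (auto simp: infdist_def)
  then show ?thesis by (simp add: infdist_nonneg)
next
  case False
  then obtain u v where u: "u \<in> X" "infdist x X = dist x u" and v: "v \<in> Y" "infdist y Y = dist y v"
    using infdist_attains_inf assms by metis
  have "infdist (x, y) (X \<times> Y) \<le> dist (x, y) (u, v)" using u v by (intro infdist_le) auto
  also have "\<dots> \<le> dist x u + dist y v"
    by (simp add: dist_Pair_Pair sqrt_sum_squares_le_sum)
  finally show ?thesis using u v by simp
qed

section \<open>The error bound from quadratic facial violation\<close>

locale facially_regular_conic_program = complementary_conic_program K A b c xs ys
  for K :: "'e::euclidean_space set" and A :: "'e \<Rightarrow> 'f::euclidean_space"
    and b :: 'f and c :: 'e and xs :: 'e and ys :: 'f +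
  assumes primal_qfv: "quadratic_facial_violation K (c + adjoint A ys)"
    and dual_qfv: "quadratic_facial_violation (dual_cone K) xs"
begin

lemma error_bound:
  obtains R M where "R > 0" "M > 0"
    "\<And>x s y. x \<in> K \<Longrightarrow> s \<in> dual_cone K \<Longrightarrow> s \<bullet> x = 0 \<Longrightarrow> dist (x, y) (xs, ys) \<le> R \<Longrightarrow>
       infdist (x, y) Z \<le> M * (norm (c + adjoint A y - s) + norm (A x - b))"
proof -
  let ?C = "cone_face K ss" and ?F = "cone_face (dual_cone K) xs"
  obtain L where L: "L > 0" "\<And>u. norm (adjoint A u) \<le> L * norm u"
    using linear_bounded_pos[OF lin_At] by auto
  obtain \<delta>1 where \<delta>1: "\<delta>1 > 0" "\<And>t. t \<in> ?C \<Longrightarrow> dist t xs \<le> \<delta>1 \<Longrightarrow> 2 *\<^sub>R t - xs \<in> ?C"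
    using rel_interior_extrapolate[OF xs(3)] by blast
  obtain \<delta>2 where \<delta>2: "\<delta>2 > 0" "\<And>t. t \<in> ?F \<Longrightarrow> dist t ss \<le> \<delta>2 \<Longrightarrow> 2 *\<^sub>R t - ss \<in> ?F"
    using rel_interior_extrapolate[OF ss(2)] by blast
  \<comment> \<open>The projection of a point within \<open>R\<close> of the pair lies within
    \<open>2 * R\<close> of it, and its slack within \<open>L * (2 * R)\<close> of
    \<open>ss\<close>; both must fall within the extrapolation radii.\<close>
  define R where "R = min (\<delta>1 / 2) (\<delta>2 / (2 * L))"
  have R: "R > 0" "2 * R \<le> \<delta>1" "L * (2 * R) \<le> \<delta>2"
    using \<delta>1 \<delta>2 L by (auto simp: R_def min_def field_simps)
  obtain \<kappa>1 where \<kappa>1: "\<kappa>1 > 0"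
    "\<And>x. x \<in> cball xs R \<inter> K \<Longrightarrow> (infdist x ?C)\<^sup>2 \<le> \<kappa>1 * (ss \<bullet> x)"
    using primal_qfv[unfolded quadratic_facial_violation_def, rule_format, OF compact_cball, of xs R]
    unfolding ss_def by auto
  \<comment> \<open>The slack \<open>s\<close> differs from \<open>c + adjoint A y\<close> by the
    dual residual. The radius allows a residual of norm up to \<open>1\<close> and a change of
    \<open>L * R\<close> caused by \<open>y\<close>.\<close>
  obtain \<kappa>2 where \<kappa>2: "\<kappa>2 > 0"
    "\<And>s. s \<in> cball ss (1 + L * R) \<inter> dual_cone K \<Longrightarrow> (infdist s ?F)\<^sup>2 \<le> \<kappa>2 * (xs \<bullet> s)"
    using dual_qfv[unfolded quadratic_facial_violation_def, rule_format, OF compact_cball,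
        of ss "1 + L * R"] by auto
  define \<kappa> where "\<kappa> = max \<kappa>1 \<kappa>2"
  obtain M1 where M1: "M1 > 0" "\<And>x. dist xs x \<le> R \<Longrightarrow>
    infdist x (primal_solutions K A b c) \<le> M1 * (infdist x ?C + norm (A x - b))"
    using primal_regularity[OF less_imp_le[OF R(1)]] by blast
  obtain M2 where M2: "M2 > 0" "\<And>y. dist ys y \<le> R \<Longrightarrow>
    infdist y (dual_solutions K A b c) \<le> M2 * infdist (c + adjoint A y) ?F"
    using dual_regularity[OF less_imp_le[OF R(1)]] by blast
  define M where "M = max M1 M2"
  have M: "M > 0" "M1 \<le> M" "M2 \<le> M" and \<kappa>: "\<kappa> > 0" "\<kappa>1 \<le> \<kappa>" "\<kappa>2 \<le> \<kappa>"
    using M1 \<kappa>1 by (auto simp: M_def \<kappa>_def)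
  \<comment> \<open>The first two summands come from absorbing half of \<open>D\<close> into the
    left side. The summand \<open>R\<close> covers a dual residual larger than \<open>1\<close>,
    where \<open>D \<le> R\<close> already suffices.\<close>
  define M' where "M' = 8 * M\<^sup>2 * \<kappa> + 2 * M + R"
  have M': "M' > 0" using M \<kappa> R by (simp add: M'_def add_nonneg_pos)
  have amgm: "t \<le> p + q" if "t\<^sup>2 \<le> 4 * (p * q)" "0 \<le> p" "0 \<le> q" for t p q :: real
  proof (rule power2_le_imp_le)
    have "0 \<le> (p - q)\<^sup>2" by simp
    then show "t\<^sup>2 \<le> (p + q)\<^sup>2" using that(1) by (simp add: power2_eq_square algebra_simps)
  qed (use that in simp)
  have "infdist (x, y) Z \<le> M' * (norm (c + adjoint A y - s) + norm (A x - b))"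
    if x: "x \<in> K" and s: "s \<in> dual_cone K" and sx: "s \<bullet> x = 0" and near: "dist (x, y) (xs, ys) \<le> R"
    for x s y
  proof -
    define w1 w2 where "w1 = c + adjoint A y - s" and "w2 = A x - b"
    define W where "W = norm w1 + norm w2"
    define D where "D = infdist (x, y) Z"
    have W0: "0 \<le> W" and D0: "0 \<le> D" by (auto simp: W_def D_def infdist_nonneg)
    have DR: "D \<le> R" using infdist_le[OF pair_in_Z, of "(x, y)"] near by (simp add: D_def)
    have "D \<le> M' * W"
    proof (cases "norm w1 \<le> 1") \<comment> \<open>facial violation is only controlled for \<open>s\<close> in a bounded set\<close>
      case False
      then have "1 \<le> W" using norm_ge_zero[of w2] unfolding W_def by linarith
      then have "R * 1 \<le> M' * W" using R M \<kappa> by (intro mult_mono) (auto simp: M'_def)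
      then show ?thesis using DR by simp
    next
      case True
      have "closed Z" unfolding Z_def using closed_primal_solutions closed_dual_solutions by (rule closed_Times)
      then obtain xp yp where zp: "(xp, yp) \<in> Z" and D: "D = dist (x, y) (xp, yp)"
        unfolding D_def using infdist_attains_inf pair_in_Z by (metis empty_iff surj_pair)
      let ?sp = "c + adjoint A yp"
      have xd: "norm (x - xp) \<le> D" and yd: "norm (y - yp) \<le> D"
        using dist_fst_le[of "(x, y)" "(xp, yp)"] dist_snd_le[of "(x, y)" "(xp, yp)"] D
        by (auto simp: dist_norm)
      have xn: "dist x xs \<le> R" and yn: "dist y ys \<le> R"
        using dist_fst_le[of "(x, y)" "(xs, ys)"] dist_snd_le[of "(x, y)" "(xs, ys)"] near by auto
      have xpn: "dist xp xs \<le> 2 * R" and ypn: "dist yp ys \<le> 2 * R"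
        using xd yd xn yn DR dist_triangle[of xp xs x] dist_triangle[of yp ys y]
        by (auto simp: dist_norm norm_minus_commute)
      have "dist ?sp ss \<le> L * dist yp ys"
        using L(2)[of "yp - ys"] by (simp add: ss_def dist_norm linear_diff[OF lin_At])
      also have "\<dots> \<le> L * (2 * R)" using ypn L by simp
      finally have "2 *\<^sub>R ?sp - ss \<in> ?F" using \<delta>2(2) ZD(4)[OF zp] R by simp
      then have sp: "ss \<bullet> x \<le> 2 * (?sp \<bullet> x)"
        using x by (auto simp: cone_face_def dual_cone_def inner_diff_left dest!: bspec[of _ _ x])
      have "2 *\<^sub>R xp - xs \<in> ?C" using \<delta>1(2) ZD(1)[OF zp] R xpn by simp
      then have xp: "xs \<bullet> s \<le> 2 * (s \<bullet> xp)"
        using s by (auto simp: cone_face_def dual_cone_def inner_diff_right inner_commute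
            dest!: bspec[of _ _ "2 *\<^sub>R xp - xs"])
      have "?sp \<bullet> x + s \<bullet> xp = w1 \<bullet> (x - xp) - (y - yp) \<bullet> w2"
        unfolding w1_def w2_def by (rule duality_gap[OF sx zp])
      also have "\<dots> \<le> norm w1 * norm (x - xp) + norm (y - yp) * norm w2"
        using norm_cauchy_schwarz[of w1 "x - xp"]
          norm_cauchy_schwarz[of "- (y - yp)" w2, unfolded inner_minus_left norm_minus_cancel]
        by linarith
      also have "\<dots> \<le> norm w1 * D + D * norm w2"
        using xd yd by (intro add_mono mult_left_mono mult_right_mono) auto
      also have "\<dots> = W * D" by (simp add: W_def algebra_simps)
      finally have gap: "?sp \<bullet> x + s \<bullet> xp \<le> W * D" .
      have nonneg: "0 \<le> ?sp \<bullet> x" "0 \<le> s \<bullet> xp" "0 \<le> ss \<bullet> x" "0 \<le> xs \<bullet> s"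
        using ZD[OF zp] x s xs ss by (auto simp: dual_cone_def inner_commute)
      define d1 d2 where "d1 = infdist x ?C" and "d2 = infdist s ?F"
      have "d1\<^sup>2 \<le> \<kappa>1 * (ss \<bullet> x)" unfolding d1_def using \<kappa>1 x xn by (simp add: dist_commute)
      also have "\<dots> \<le> \<kappa> * (2 * (W * D))"
        using \<kappa> gap sp nonneg by (intro mult_mono) auto
      finally have d1: "d1\<^sup>2 \<le> \<kappa> * (2 * (W * D))" .
      have "dist ss s \<le> 1 + L * R"
      proof -
        have "ss - s = adjoint A (ys - y) + w1" by (simp add: w1_def ss_def linear_diff[OF lin_At])
        then have "norm (ss - s) \<le> L * norm (ys - y) + norm w1"
          using norm_triangle_ineq[of "adjoint A (ys - y)" w1] L(2)[of "ys - y"] by simp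
        moreover have "L * norm (ys - y) \<le> L * R"
          using yn L by (simp add: dist_norm norm_minus_commute)
        ultimately show ?thesis using True by (simp add: dist_norm)
      qed
      then have "d2\<^sup>2 \<le> \<kappa>2 * (xs \<bullet> s)" unfolding d2_def using \<kappa>2 s by simp
      also have "\<dots> \<le> \<kappa> * (2 * (W * D))"
        using \<kappa> gap xp nonneg by (intro mult_mono) auto
      finally have d2: "d2\<^sup>2 \<le> \<kappa> * (2 * (W * D))" .
      \<comment> \<open>The share \<open>D / 4\<close> is chosen so that the primal and dual faces
        together cost only \<open>D / 2\<close>, which is then absorbed.\<close>
      have root: "M * d \<le> D / 4 + 2 * M\<^sup>2 * \<kappa> * W" if "d\<^sup>2 \<le> \<kappa> * (2 * (W * D))" for d
      proof (rule amgm)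
        have "(M * d)\<^sup>2 \<le> M\<^sup>2 * (\<kappa> * (2 * (W * D)))"
          using that by (simp add: power_mult_distrib mult_left_mono)
        then show "(M * d)\<^sup>2 \<le> 4 * (D / 4 * (2 * M\<^sup>2 * \<kappa> * W))" by (simp add: algebra_simps)
      qed (use D0 W0 \<kappa> in auto)
      have "D \<le> infdist x (primal_solutions K A b c) + infdist y (dual_solutions K A b c)"
        unfolding D_def Z_def
        using closed_primal_solutions closed_dual_solutions by (rule infdist_Times_le)
      also have "\<dots> \<le> M1 * (d1 + norm w2) + M2 * (d2 + norm w1)"
      proof (rule add_mono)
        show "infdist x (primal_solutions K A b c) \<le> M1 * (d1 + norm w2)"
          unfolding d1_def w2_def using M1(2) xn by (simp add: dist_commute)
        \<comment> \<open>Facial violation controls the distance of \<open>s\<close> to the face,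
          while regularity needs that of \<open>c + adjoint A y\<close>; the two differ by at most
          \<open>norm w1\<close>.\<close>
        have "infdist y (dual_solutions K A b c) \<le> M2 * infdist (c + adjoint A y) ?F"
          using M2(2) yn by (simp add: dist_commute)
        also have "\<dots> \<le> M2 * (d2 + norm w1)"
          using infdist_triangle[of "c + adjoint A y" ?F s] M2(1) by (simp add: d2_def w1_def dist_norm)
        finally show "infdist y (dual_solutions K A b c) \<le> M2 * (d2 + norm w1)" .
      qed
      also have "\<dots> \<le> M * (d1 + norm w2) + M * (d2 + norm w1)"
        using M by (intro add_mono mult_right_mono) (auto simp: d1_def d2_def infdist_nonneg)
      also have "\<dots> = M * d1 + M * d2 + M * W" by (simp add: W_def algebra_simps)
      finally have "D \<le> (D / 4 + 2 * M\<^sup>2 * \<kappa> * W) + (D / 4 + 2 * M\<^sup>2 * \<kappa> * W) + M * W"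
        using root[OF d1] root[OF d2] by linarith
      then have "D \<le> (8 * M\<^sup>2 * \<kappa> + 2 * M) * W" by (simp add: algebra_simps)
      also have "\<dots> \<le> M' * W" using R W0 by (intro mult_right_mono) (auto simp: M'_def)
      finally show ?thesis .
    qed
    then show ?thesis by (simp add: D_def W_def w1_def w2_def)
  qed
  with R(1) M' show ?thesis by (rule that)
qed

end

section \<open>The algorithms\<close>

lemma arg_min_eqI:
  fixes F :: "'a \<Rightarrow> 'b::linorder"
  assumes "\<And>u. u \<noteq> p \<Longrightarrow> F p < F u"
  shows "arg_min F (\<lambda>_. True) = p"
  unfolding arg_min_def
proof (rule some_equality)
  show "is_arg_min F (\<lambda>_. True) p"
    unfolding is_arg_min_def using assms by (metis less_asym)
  show "u = p" if "is_arg_min F (\<lambda>_. True) u" for u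
    using that assms unfolding is_arg_min_def by blast
qed

text \<open>After completing the square, the subproblems over convex sets all have this shape;
  strict minimality of the projection determines the choice made by \<open>arg_min\<close>.\<close>

lemma arg_min_closest_point:
  fixes S :: "'a::euclidean_space set"
  assumes S: "convex S" "closed S" "S \<noteq> {}" and a: "a > 0"
    and F: "\<And>u. F u = (if u \<in> S then ereal (a * (norm (u - w))\<^sup>2 + d) else \<infinity>)"
  shows "arg_min F (\<lambda>_. True) = closest_point S w"
proof (rule arg_min_eqI)
  let ?p = "closest_point S w"
  have p: "?p \<in> S" using S by (intro closest_point_in_set) auto
  fix u assume u: "u \<noteq> ?p"
  show "F ?p < F u"
  proof (cases "u \<in> S")
    case True
    have "norm (?p - w) < norm (u - w)"
      using closest_point_lt[OF S(1,2) True u] by (simp add: dist_norm norm_minus_commute)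
    then have "(norm (?p - w))\<^sup>2 < (norm (u - w))\<^sup>2" by (intro power_strict_mono) auto
    then show ?thesis using True p a by (simp add: F)
  qed (use p in \<open>simp add: F\<close>)
qed

lemma convex_conjugate_indicator_singleton:
  "convex_conjugate (convex_indicator {b}) u = ereal (u \<bullet> b)"
  unfolding convex_conjugate_def
proof (rule antisym)
  show "(SUP x. ereal (u \<bullet> x) - convex_indicator {b} x) \<le> ereal (u \<bullet> b)"
    by (rule SUP_least) (simp add: convex_indicator_def)
  show "ereal (u \<bullet> b) \<le> (SUP x. ereal (u \<bullet> x) - convex_indicator {b} x)"
    by (rule SUP_upper2[of b]) (auto simp: convex_indicator_def)
qed

text \<open>If \<open>(v - c) \<bullet> x > 0\<close> for some \<open>x\<close> in the cone, scaling
  \<open>x\<close> makes the supremum infinite; otherwise it is attained at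
  \<open>0\<close>.\<close>

lemma convex_conjugate_primal_objective:
  assumes K: "convex_cone K"
  shows "convex_conjugate (primal_objective K c) v = (if c - v \<in> dual_cone K then 0 else \<infinity>)"
proof (cases "c - v \<in> dual_cone K")
  case True
  have "convex_conjugate (primal_objective K c) v = 0"
    unfolding convex_conjugate_def
  proof (rule antisym)
    show "(SUP x. ereal (v \<bullet> x) - primal_objective K c x) \<le> 0"
      using True
      by (intro SUP_least)
        (auto simp: primal_objective_def convex_indicator_def dual_cone_def inner_diff_left)
    show "0 \<le> (SUP x. ereal (v \<bullet> x) - primal_objective K c x)"
      using convex_cone_contains_0[OF K]
      by (intro SUP_upper2[of 0]) (auto simp: primal_objective_def convex_indicator_def)
  qed
  then show ?thesis using True by simp
next
  case False
  then obtain x where x: "x \<in> K" and t: "0 < (v - c) \<bullet> x"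
    by (auto simp: dual_cone_def not_le inner_diff_left)
  have "convex_conjugate (primal_objective K c) v = \<infinity>"
    unfolding convex_conjugate_def
  proof (rule SUP_PInfty)
    fix n :: nat
    define r where "r = n / ((v - c) \<bullet> x)"
    have "r *\<^sub>R x \<in> K" using K x t by (intro convex_cone_scaleR) (auto simp: r_def)
    then have "ereal (v \<bullet> (r *\<^sub>R x)) - primal_objective K c (r *\<^sub>R x) = ereal ((v - c) \<bullet> (r *\<^sub>R x))"
      by (simp add: primal_objective_def convex_indicator_def inner_diff_left right_diff_distrib)
    also have "(v - c) \<bullet> (r *\<^sub>R x) = n" using t by (simp add: r_def)
    finally show "\<exists>i\<in>UNIV. ereal (real n) \<le> ereal (v \<bullet> i) - primal_objective K c i" by (metis UNIV_I order_refl)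
  qed
  then show ?thesis using False by simp
qed

lemma power2_norm_add:
  fixes p q :: "'a::real_inner"
  shows "(norm (p + q))\<^sup>2 = (norm p)\<^sup>2 + 2 * (p \<bullet> q) + (norm q)\<^sup>2"
  by (simp add: power2_norm_eq_inner inner_simps inner_commute)

lemma power2_norm_diff_ge:
  fixes p q :: "'a::real_inner"
  assumes "q \<bullet> p \<le> 0"
  shows "(norm p)\<^sup>2 + (norm q)\<^sup>2 \<le> (norm (p - q))\<^sup>2"
  using assms power2_norm_add[of p "- q"] by (simp add: inner_commute)

lemma prox_complete_square:
  fixes c :: "'a::real_inner"
  shows "\<eta> * (c \<bullet> u) + (norm (u - w))\<^sup>2 / 2
    = 1/2 * (norm (u - (w - \<eta> *\<^sub>R c)))\<^sup>2 + (\<eta> * (c \<bullet> w) - (\<eta> * norm c)\<^sup>2 / 2)"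
proof -
  have e: "u - (w - \<eta> *\<^sub>R c) = (u - w) + \<eta> *\<^sub>R c" by simp
  show ?thesis
    unfolding e power2_norm_add
    by (simp add: power_mult_distrib inner_diff_left inner_commute algebra_simps)
qed

lemma prox_primal_objective:
  fixes K :: "'e::euclidean_space set"
  assumes "closed K" "convex_cone K" "0 < \<eta>"
  shows "prox (\<lambda>u. ereal \<eta> * primal_objective K c u) w = closest_point K (w - \<eta> *\<^sub>R c)"
  unfolding prox_def
proof (rule arg_min_closest_point[where a = "1/2" and d = "\<eta> * (c \<bullet> w) - (\<eta> * norm c)\<^sup>2 / 2"])
  fix u
  show "ereal \<eta> * primal_objective K c u + ereal ((norm (u - w))\<^sup>2 / 2) =
      (if u \<in> K then ereal (1/2 * (norm (u - (w - \<eta> *\<^sub>R c)))\<^sup>2 + (\<eta> * (c \<bullet> w) - (\<eta> * norm c)\<^sup>2 / 2)) else \<infinity>)"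
    using assms(3) prox_complete_square[of \<eta> c u w]
    by (simp add: primal_objective_def convex_indicator_def)
qed (use assms in \<open>auto simp: convex_cone_def\<close>)

lemma prox_linear:
  fixes b :: "'f::euclidean_space"
  shows "prox (\<lambda>u. ereal \<eta> * ereal (u \<bullet> b)) w = w - \<eta> *\<^sub>R b"
proof -
  have "prox (\<lambda>u. ereal \<eta> * ereal (u \<bullet> b)) w = closest_point UNIV (w - \<eta> *\<^sub>R b)"
    unfolding prox_def
  proof (rule arg_min_closest_point[where a = "1/2" and d = "\<eta> * (b \<bullet> w) - (\<eta> * norm b)\<^sup>2 / 2"])
    fix u
    show "ereal \<eta> * ereal (u \<bullet> b) + ereal ((norm (u - w))\<^sup>2 / 2) =
        (if u \<in> UNIV then ereal (1/2 * (norm (u - (w - \<eta> *\<^sub>R b)))\<^sup>2 + (\<eta> * (b \<bullet> w) - (\<eta> * norm b)\<^sup>2 / 2)) else \<infinity>)"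
      using prox_complete_square[of \<eta> b u w] by (simp add: inner_commute)
  qed auto
  then show ?thesis by (simp add: closest_point_self)
qed

section \<open>Iterations as perturbed optimality conditions\<close>

context complementary_conic_program
begin

text \<open>Cone membership and complementarity are kept exact, for the shifted slack
  \<open>c + adjoint A y - w1\<close>; only the two linear equations carry errors.\<close>

definition kkt_residual :: "'e \<Rightarrow> 'f \<Rightarrow> 'e \<Rightarrow> 'f \<Rightarrow> bool" where
  "kkt_residual x y w1 w2 \<longleftrightarrow>
     x \<in> K \<and> c + adjoint A y - w1 \<in> dual_cone K \<and> (c + adjoint A y - w1) \<bullet> x = 0 \<and> A x - b = w2"

lemma kkt_residual_monotone:
  assumes "kkt_residual x y w1 w2" "w \<in> Z"
  shows "(y - snd w) \<bullet> w2 \<le> w1 \<bullet> (x - fst w)"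
  using monotone[of x "c + adjoint A y - w1" "fst w" "snd w" y] assms by (auto simp: kkt_residual_def)

definition pdhg_step :: "real \<Rightarrow> 'e \<times> 'f \<Rightarrow> 'e \<times> 'f \<Rightarrow> bool" where
  "pdhg_step \<eta> z z' \<longleftrightarrow> (let (dx, dy) = z' - z in
     kkt_residual (fst z') (snd z') (adjoint A dy - dx /\<^sub>R \<eta>) (dy /\<^sub>R \<eta> - A dx))"

text \<open>Both residuals depend on the step only through \<open>d\<close>, which is why ADMM is
  measured by \<open>J\<close> alone.\<close>

definition admm_step :: "real \<Rightarrow> 'e \<times> 'f \<Rightarrow> 'e \<times> 'f \<Rightarrow> bool" where
  "admm_step \<rho> z z' \<longleftrightarrow> (let (dx, dy) = z' - z; d = dx - \<rho> *\<^sub>R adjoint A dy in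
     kkt_residual (fst z') (snd z') (- d /\<^sub>R \<rho>) (- A d))"

text \<open>The new primal point is the projection of \<open>p\<close> to \<open>K\<close>. By
  Moreau decomposition, the rescaled projection error is the exact slack; the update of
  \<open>y\<close> gives the primal residual.\<close>

lemma pdhg_iterates_step:
  assumes "pdhg_iterates K A b c \<eta> x y" "0 < \<eta>"
  shows "pdhg_step \<eta> (x k, y k) (x (Suc k), y (Suc k))"
proof -
  define p where "p = x k - \<eta> *\<^sub>R adjoint A (y k) - \<eta> *\<^sub>R c"
  have x': "x (Suc k) = closest_point K p"
    using assms prox_primal_objective[OF closed_K cone_K assms(2)]
    by (simp add: pdhg_iterates_def Let_def p_def)
  have y': "y (Suc k) = y k + \<eta> *\<^sub>R A (2 *\<^sub>R x (Suc k) - x k) - \<eta> *\<^sub>R b"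
    using assms(1) prox_linear[of \<eta> b]
    by (simp add: pdhg_iterates_def Let_def convex_conjugate_indicator_singleton)
  let ?w1 = "adjoint A (y (Suc k) - y k) - (x (Suc k) - x k) /\<^sub>R \<eta>"
  have s: "c + adjoint A (y (Suc k)) - ?w1 = (x (Suc k) - p) /\<^sub>R \<eta>"
    using assms(2) by (simp add: p_def linear_diff[OF lin_At] algebra_simps)
  have "c + adjoint A (y (Suc k)) - ?w1 \<in> dual_cone K" "(c + adjoint A (y (Suc k)) - ?w1) \<bullet> x (Suc k) = 0"
    unfolding s using closest_point_convex_cone[OF closed_K cone_K, of p] assms(2)
    by (auto simp: x' intro!: convex_cone_scaleR convex_cone_dual_cone)
  moreover have "A (x (Suc k)) - b = (y (Suc k) - y k) /\<^sub>R \<eta> - A (x (Suc k) - x k)"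
  proof -
    have "A (2 *\<^sub>R x (Suc k) - x k) = 2 *\<^sub>R A (x (Suc k)) - A (x k)"
      by (simp only: linear_diff[OF lin_A] linear_cmul[OF lin_A])
    then show ?thesis
      using assms(2) by (simp add: y' linear_diff[OF lin_A] algebra_simps scaleR_2)
  qed
  ultimately show ?thesis
    using closest_point_convex_cone(1)[OF closed_K cone_K, of p]
    by (simp add: pdhg_step_def kkt_residual_def x')
qed

text \<open>The kernel of this map equals that of the adjoint, which is trivial, and an injective
  endomorphism in finite dimension is onto.\<close>

lemma surj_normal_map: "surj (\<lambda>u. A (adjoint A u))"
proof -
  have lin: "linear (\<lambda>u. A (adjoint A u))"
    using linear_compose[OF lin_At lin_A] by (simp add: o_def)
  have "u = 0" if "A (adjoint A u) = 0" for u
  proof -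
    have "adjoint A u \<bullet> adjoint A u = 0" using that by (simp add: adj)
    then show "u = 0" using adjoint_left_inverse by (metis inner_eq_zero_iff linear_0)
  qed
  then have "inj (\<lambda>u. A (adjoint A u))" using linear_injective_0[OF lin] by blast
  then show ?thesis using linear_injective_imp_surjective[OF lin] by blast
qed

text \<open>The \<open>v\<close>-update projects \<open>p\<close> to \<open>c\<close> minus the dual
  cone. Hence the new \<open>x\<close>, a positive multiple of \<open>p - v\<close>, is a normal
  vector: it lies in the bidual cone and is complementary to the slack \<open>c - v\<close>.\<close>

lemma admm_iterates_step:
  assumes "admm_iterates K A b c \<rho> v x y" "0 < \<rho>"
  shows "admm_step \<rho> (x k, y k) (x (Suc k), y (Suc k))"
proof -
  define S where "S = {w. c - w \<in> dual_cone K}"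
  define p where "p = x k /\<^sub>R \<rho> - adjoint A (y k)"
  let ?x = "x (Suc k)" and ?y = "y (Suc k)" and ?v = "v (Suc k)"
  have S: "S = (\<lambda>w. c + w) ` uminus ` dual_cone K"
    by (force simp: S_def image_iff intro: bexI[of _ "c - _"])
  have S': "closed S" "convex S" "S \<noteq> {}"
    unfolding S using closed_dual_cone[of K] convex_cone_dual_cone[of K]
    by (auto simp: convex_cone_def intro!: closed_translation convex_translation closed_negations convex_negations)
  have v: "?v = closest_point S p"
  proof -
    have "arg_min (\<lambda>w. convex_conjugate (primal_objective K c) w - ereal (x k \<bullet> w)
        + ereal (\<rho> / 2 * (norm (w + adjoint A (y k)))\<^sup>2)) (\<lambda>_. True) = closest_point S p"
    proof (rule arg_min_closest_point[where a = "\<rho>/2" and d = "(norm (x k))\<^sup>2 / (2 * \<rho>) - p \<bullet> x k"])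
      fix w
      have e: "w + adjoint A (y k) = (w - p) + x k /\<^sub>R \<rho>" by (simp add: p_def)
      have "\<rho> / 2 * (norm (w + adjoint A (y k)))\<^sup>2 - x k \<bullet> w
          = \<rho> / 2 * (norm (w - p))\<^sup>2 + ((norm (x k))\<^sup>2 / (2 * \<rho>) - p \<bullet> x k)"
        unfolding e power2_norm_add using assms(2)
        by (simp add: power_mult_distrib inner_diff_left inner_diff_right inner_commute field_simps
            power2_eq_square)
      then show "convex_conjugate (primal_objective K c) w - ereal (x k \<bullet> w)
          + ereal (\<rho> / 2 * (norm (w + adjoint A (y k)))\<^sup>2) =
          (if w \<in> S then ereal (\<rho> / 2 * (norm (w - p))\<^sup>2 + ((norm (x k))\<^sup>2 / (2 * \<rho>) - p \<bullet> x k)) else \<infinity>)"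
        by (simp add: convex_conjugate_primal_objective[OF cone_K] S_def)
    qed (use S' assms in auto)
    then show ?thesis using assms(1) by (simp add: admm_iterates_def Let_def)
  qed
  have x: "?x = \<rho> *\<^sub>R (p - ?v)"
  proof -
    have "?x = x k - \<rho> *\<^sub>R (?v + adjoint A (y k))"
      using assms(1) unfolding admm_iterates_def Let_def by blast
    then show ?thesis using assms(2) by (simp add: p_def algebra_simps)
  qed
  have s: "c - ?v \<in> dual_cone K"
    using closest_point_in_set[OF S'(1,3)] by (simp add: v S_def)
  have ge: "0 \<le> ?x \<bullet> (s' - (c - ?v))" if "s' \<in> dual_cone K" for s'
  proof -
    have "c - s' \<in> S" using that by (simp add: S_def)
    then have "(p - ?v) \<bullet> (c - s' - ?v) \<le> 0"
      unfolding v using closest_point_dot[OF S'(2,1)] by blast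
    then have "0 \<le> (p - ?v) \<bullet> (s' - (c - ?v))" by (simp add: inner_simps)
    then show ?thesis unfolding x using assms(2) by simp
  qed
  have xK: "?x \<in> K" "?x \<bullet> (c - ?v) = 0"
    using convex_cone_variational_inequality[OF convex_cone_dual_cone s ge]
      dual_dual_cone_subset[OF closed_K cone_K] by auto
  \<comment> \<open>Setting the gradient of the \<open>y\<close>-subproblem to zero gives this
    normal equation. Injectivity of the adjoint then makes \<open>y0\<close> the strict
    minimizer.\<close>
  obtain y0 where y0: "A (adjoint A y0) = (A ?x - b) /\<^sub>R \<rho> - A ?v"
    using surj_normal_map by (metis surjD)
  have opt: "\<rho> *\<^sub>R A (?v + adjoint A y0) = A ?x - b"
    using assms(2) by (simp add: linear_add[OF lin_A] y0)
  have "arg_min (\<lambda>u. ereal (u \<bullet> b) - ereal (A ?x \<bullet> u) + ereal (\<rho> / 2 * (norm (?v + adjoint A u))\<^sup>2))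
      (\<lambda>_. True) = y0"
  proof (rule arg_min_eqI)
    fix u assume "u \<noteq> y0"
    define d where "d = u - y0"
    have "d \<noteq> 0" using \<open>u \<noteq> y0\<close> by (simp add: d_def)
    then have pos: "0 < (norm (adjoint A d))\<^sup>2"
      using adjoint_left_inverse by (metis linear_0 norm_eq_zero zero_less_power2)
    have u: "u = y0 + d" by (simp add: d_def)
    have "(norm (?v + adjoint A u))\<^sup>2 = (norm (?v + adjoint A y0))\<^sup>2
        + 2 * ((?v + adjoint A y0) \<bullet> adjoint A d) + (norm (adjoint A d))\<^sup>2"
      unfolding u linear_add[OF lin_At] power2_norm_eq_inner by (simp add: inner_simps inner_commute)
    moreover have "\<rho> * ((?v + adjoint A y0) \<bullet> adjoint A d) = (A ?x - b) \<bullet> d"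
      unfolding opt[symmetric] by (simp add: adj)
    ultimately have "u \<bullet> b - A ?x \<bullet> u + \<rho> / 2 * (norm (?v + adjoint A u))\<^sup>2
      = y0 \<bullet> b - A ?x \<bullet> y0 + \<rho> / 2 * (norm (?v + adjoint A y0))\<^sup>2 + \<rho> / 2 * (norm (adjoint A d))\<^sup>2"
      by (simp add: u inner_simps inner_commute algebra_simps)
    then show "ereal (y0 \<bullet> b) - ereal (A ?x \<bullet> y0) + ereal (\<rho> / 2 * (norm (?v + adjoint A y0))\<^sup>2)
        < ereal (u \<bullet> b) - ereal (A ?x \<bullet> u) + ereal (\<rho> / 2 * (norm (?v + adjoint A u))\<^sup>2)"
      using pos assms(2) by simp
  qed
  then have "?y = y0"
    using assms(1) by (simp add: admm_iterates_def Let_def convex_conjugate_indicator_singleton)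
  then have r2: "A ?x - b = \<rho> *\<^sub>R A (?v + adjoint A ?y)" using opt by simp
  \<comment> \<open>This \<open>d\<close> is \<open>J\<close> of the step; it equals
    \<open>- \<rho>\<close> times the residual of the coupling between the new \<open>v\<close> and
    \<open>y\<close>.\<close>
  define d where "d = (?x - x k) - \<rho> *\<^sub>R adjoint A (?y - y k)"
  have d: "?v + adjoint A ?y = - d /\<^sub>R \<rho>"
    using assms(2) unfolding d_def x p_def by (simp add: linear_diff[OF lin_At] algebra_simps)
  have dual: "c + adjoint A ?y - (- d /\<^sub>R \<rho>) = c - ?v" unfolding d[symmetric] by simp
  have primal: "A ?x - b = - A d"
    unfolding r2 d using assms(2) by (simp add: linear_cmul[OF lin_A] linear_neg[OF lin_A])
  have "kkt_residual ?x ?y (- d /\<^sub>R \<rho>) (- A d)"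
    unfolding kkt_residual_def dual primal using s xK by (simp add: inner_commute)
  then show ?thesis by (simp add: admm_step_def d_def Let_def del: minus_diff_eq)
qed

end

section \<open>Linear convergence of the two algorithms\<close>

context facially_regular_conic_program
begin

lemma kkt_error_bound:
  obtains R M where "R > 0" "M > 0"
    "\<And>z w1 w2. kkt_residual (fst z) (snd z) w1 w2 \<Longrightarrow> dist z (xs, ys) \<le> R \<Longrightarrow>
       infdist z Z \<le> M * (norm w1 + norm w2)"
proof -
  obtain R M where R: "R > 0" "M > 0" and eb:
    "\<And>x s y. x \<in> K \<Longrightarrow> s \<in> dual_cone K \<Longrightarrow> s \<bullet> x = 0 \<Longrightarrow> dist (x, y) (xs, ys) \<le> R \<Longrightarrow>
       infdist (x, y) Z \<le> M * (norm (c + adjoint A y - s) + norm (A x - b))"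
    using error_bound by metis
  show thesis
  proof (rule that[OF R])
    fix z w1 w2 assume "kkt_residual (fst z) (snd z) w1 w2" "dist z (xs, ys) \<le> R"
    then show "infdist z Z \<le> M * (norm w1 + norm w2)"
      using eb[of "fst z" "c + adjoint A (snd z) - w1" "snd z"] by (auto simp: kkt_residual_def)
  qed
qed

lemma pdhg_linear_convergence:
  assumes \<eta>: "0 < \<eta>" "\<eta> < 1 / onorm A"
  shows "\<exists>r>0. \<exists>r'>0. \<exists>q. 0 < q \<and> q < 1 \<and>
    (\<forall>z. (\<forall>k. pdhg_step \<eta> (z k) (z (Suc k))) \<and> z 0 \<in> cball (xs, ys) r \<longrightarrow>
         (\<forall>k. infdist (z k) Z \<le> q ^ k * r'))"
proof -
  define a where "a = onorm A"
  \<comment> \<open>The step-size metric: identity over \<open>\<eta>\<close> in the diagonal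
    blocks, minus \<open>A\<close> and minus its adjoint off the diagonal. \<open>B\<close> is the
    associated symmetric bilinear form.\<close>
  define N where "N d = (norm (fst d))\<^sup>2 / \<eta> - 2 * (A (fst d) \<bullet> snd d) + (norm (snd d))\<^sup>2 / \<eta>"
    for d :: "'e \<times> 'f"
  define B where "B p q = (fst p \<bullet> fst q) / \<eta> - A (fst p) \<bullet> snd q - A (fst q) \<bullet> snd p + (snd p \<bullet> snd q) / \<eta>"
    for p q :: "'e \<times> 'f"
  have bl: "bounded_linear A" using lin_A by (simp add: linear_conv_bounded_linear)
  have a0: "0 \<le> a" unfolding a_def using bl by (rule onorm_pos_le)
  have aA: "norm (A u) \<le> a * norm u" for u unfolding a_def using bl by (rule onorm)
  \<comment> \<open>Division by zero yields \<open>0\<close>, so \<open>a = 0\<close> would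
    contradict the upper bound on \<open>\<eta>\<close>.\<close>
  have "a \<noteq> 0" using \<eta> by (auto simp: a_def)
  then have a\<eta>: "a < 1 / \<eta>" using \<eta> a0 by (simp add: a_def field_simps)
  have sq: "(norm d)\<^sup>2 = (norm (fst d))\<^sup>2 + (norm (snd d))\<^sup>2" for d :: "'e \<times> 'f"
    by (cases d) (simp add: norm_Pair)
  have cross: "\<bar>2 * (A (fst d) \<bullet> snd d)\<bar> \<le> a * (norm d)\<^sup>2" for d :: "'e \<times> 'f"
  proof -
    have "\<bar>A (fst d) \<bullet> snd d\<bar> \<le> norm (A (fst d)) * norm (snd d)" by (rule Cauchy_Schwarz_ineq2)
    also have "\<dots> \<le> a * norm (fst d) * norm (snd d)" using aA by (intro mult_right_mono) auto
    finally have "\<bar>2 * (A (fst d) \<bullet> snd d)\<bar> \<le> a * (2 * norm (fst d) * norm (snd d))" by simp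
    also have "\<dots> \<le> a * (norm d)\<^sup>2"
      unfolding sq using a0 by (intro mult_left_mono sum_squares_bound)
    finally show ?thesis .
  qed
  have Neq: "N d = (norm d)\<^sup>2 / \<eta> - 2 * (A (fst d) \<bullet> snd d)" for d
    by (simp add: N_def sq add_divide_distrib)
  have Nlow: "(1 / \<eta> - a) * (norm d)\<^sup>2 \<le> N d" and Nup: "N d \<le> (1 / \<eta> + a) * (norm d)\<^sup>2" for d
    using cross[of d] unfolding Neq by (auto simp: algebra_simps abs_le_iff)
  have Ndiff: "N (p - q) = N p + N q - 2 * B p q" for p q
    unfolding N_def B_def
    by (simp add: power2_norm_eq_inner inner_simps inner_commute linear_diff[OF lin_A] algebra_simps
        add_divide_distrib diff_divide_distrib)
  define m where "m = 1 / \<eta> - a"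
  have m: "m > 0" using a\<eta> by (simp add: m_def)
  obtain L where L: "L > 0" "\<And>u. norm (adjoint A u) \<le> L * norm u"
    using linear_bounded_pos[OF lin_At] by auto
  obtain R M where R: "R > 0" "M > 0" and eb:
    "\<And>z w1 w2. kkt_residual (fst z) (snd z) w1 w2 \<Longrightarrow> dist z (xs, ys) \<le> R \<Longrightarrow>
       infdist z Z \<le> M * (norm w1 + norm w2)" using kkt_error_bound by metis
  define G where "G = M * (L + 1 / \<eta> + (1 / \<eta> + a))"
  have G: "G > 0" using R L a0 \<eta> by (simp add: G_def add_pos_nonneg)
  show ?thesis
  proof (rule fejer_linear_convergence[where N = N and p = "(xs, ys)" and R = R and \<alpha> = "1 / \<eta> + a" and \<beta> = "1 / m"
        and \<gamma> = "G\<^sup>2 / m"])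
    show "0 \<le> N d" for d using Nlow[of d] m order_trans[of 0 "m * (norm d)\<^sup>2"] by (simp add: m_def)
    show "1 / \<eta> + a > 0" "1 / m > 0" "G\<^sup>2 / m > 0" using \<eta> a0 m G by (auto intro: add_pos_nonneg)
    fix z z' assume T: "pdhg_step \<eta> z z'"
    define dx dy where "dx = fst (z' - z)" and "dy = snd (z' - z)"
    let ?w1 = "adjoint A dy - dx /\<^sub>R \<eta>" and ?w2 = "dy /\<^sub>R \<eta> - A dx"
    have kkt: "kkt_residual (fst z') (snd z') ?w1 ?w2"
      using T by (simp add: pdhg_step_def dx_def dy_def Let_def case_prod_beta)
    show fejer: "N (z' - w) + N (z' - z) \<le> N (z - w)" if w: "w \<in> Z" for w
    proof -
      \<comment> \<open>Up to sign, the two residuals are the blocks of the metric applied to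
        \<open>z' - z\<close>, so monotonicity of the optimality conditions is exactly this
        inequality.\<close>
      have "B (z' - w) (z' - z) \<le> 0"
        using kkt_residual_monotone[OF kkt w]
        by (simp add: B_def dx_def dy_def adj inner_diff_right inner_diff_left divide_inverse inner_commute
            linear_diff[OF lin_A] algebra_simps)
      moreover have "z - w = (z' - w) - (z' - z)" by simp
      ultimately show ?thesis using Ndiff[of "z' - w" "z' - z"] by simp
    qed
    show "(norm (z' - w))\<^sup>2 \<le> 1 / m * N (z - w)" if w: "w \<in> Z" for w
    proof -
      have "0 \<le> N (z' - z)"
        using Nlow[of "z' - z"] m order_trans[of 0 "m * (norm (z' - z))\<^sup>2"] by (simp add: m_def)
      then have "m * (norm (z' - w))\<^sup>2 \<le> N (z - w)"
        using fejer[OF w] Nlow[of "z' - w"] by (simp add: m_def)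
      then show ?thesis using m by (simp add: field_simps)
    qed
    show "(infdist z' Z)\<^sup>2 \<le> G\<^sup>2 / m * N (z' - z)" if near: "dist z' (xs, ys) \<le> R"
    proof -
      let ?n = "norm (z' - z)"
      have n: "norm dx \<le> ?n" "norm dy \<le> ?n"
        unfolding dx_def dy_def by (metis norm_fst_le norm_snd_le prod.collapse)+
      have "norm ?w1 \<le> norm (adjoint A dy) + norm (dx /\<^sub>R \<eta>)" by (rule norm_triangle_ineq4)
      also have "\<dots> \<le> L * norm dy + norm dx / \<eta>"
        using L(2) \<eta> by (simp add: divide_inverse mult.commute)
      also have "\<dots> \<le> L * ?n + ?n / \<eta>"
        using n L \<eta> by (intro add_mono mult_left_mono divide_right_mono) auto
      finally have 1: "norm ?w1 \<le> L * ?n + ?n / \<eta>" .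
      have "norm ?w2 \<le> norm (dy /\<^sub>R \<eta>) + norm (A dx)" by (rule norm_triangle_ineq4)
      also have "\<dots> \<le> norm dy / \<eta> + a * norm dx"
        using aA \<eta> by (simp add: divide_inverse mult.commute)
      also have "\<dots> \<le> ?n / \<eta> + a * ?n"
        using n a0 \<eta> by (intro add_mono mult_left_mono divide_right_mono) auto
      finally have "norm ?w1 + norm ?w2 \<le> (L + 1 / \<eta> + (1 / \<eta> + a)) * ?n"
        using 1 by (simp add: algebra_simps)
      then have "M * (norm ?w1 + norm ?w2) \<le> M * ((L + 1 / \<eta> + (1 / \<eta> + a)) * ?n)"
        using R by (intro mult_left_mono) auto
      then have "infdist z' Z \<le> G * ?n" using eb[OF kkt near] by (simp add: G_def mult.assoc)
      then have "(infdist z' Z)\<^sup>2 \<le> (G * ?n)\<^sup>2" by (intro power_mono infdist_nonneg)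
      also have "\<dots> = G\<^sup>2 / m * (m * ?n\<^sup>2)" using m by (simp add: power_mult_distrib)
      also have "\<dots> \<le> G\<^sup>2 / m * N (z' - z)"
        using Nlow[of "z' - z"] m by (intro mult_left_mono) (auto simp: m_def)
      finally show ?thesis .
    qed
  qed (use pair_in_Z R Nup in auto)
qed

text \<open>Here \<open>N\<close> is the square of a mere seminorm, as \<open>J\<close> has a
  kernel, so the Fejer inequality alone does not bound \<open>z' - w\<close>. The Lipschitz bound
  comes instead from the structure of the update.\<close>

lemma admm_linear_convergence:
  assumes \<rho>: "0 < \<rho>"
  shows "\<exists>r>0. \<exists>r'>0. \<exists>q. 0 < q \<and> q < 1 \<and>
    (\<forall>z. (\<forall>k. admm_step \<rho> (z k) (z (Suc k))) \<and> z 0 \<in> cball (xs, ys) r \<longrightarrow>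
         (\<forall>k. infdist (z k) Z \<le> q ^ k * r'))"
proof -
  define J where "J d = fst d - \<rho> *\<^sub>R adjoint A (snd d)" for d :: "'e \<times> 'f"
  define N where "N d = (norm (J d))\<^sup>2" for d
  have Jdiff: "J (p - q) = J p - J q" for p q
    by (simp add: J_def linear_diff[OF lin_At] algebra_simps)
  obtain a where a: "a > 0" "\<And>u. norm (A u) \<le> a * norm u"
    using linear_bounded_pos[OF lin_A] by auto
  obtain L where L: "L > 0" "\<And>u. norm (adjoint A u) \<le> L * norm u"
    using linear_bounded_pos[OF lin_At] by auto
  obtain G where G: "G > 0" "\<And>u. norm u \<le> G * norm (adjoint A u)"
    using adjoint_left_inverse by metis
  obtain R M where R: "R > 0" "M > 0" and eb:
    "\<And>z w1 w2. kkt_residual (fst z) (snd z) w1 w2 \<Longrightarrow> dist z (xs, ys) \<le> R \<Longrightarrow>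
       infdist z Z \<le> M * (norm w1 + norm w2)" using kkt_error_bound by metis
  have Nup: "N d \<le> (1 + \<rho> * L)\<^sup>2 * (norm d)\<^sup>2" for d
  proof -
    have n: "norm (fst d) \<le> norm d" "norm (snd d) \<le> norm d"
      by (metis norm_fst_le norm_snd_le prod.collapse)+
    have "norm (J d) \<le> norm (fst d) + norm (\<rho> *\<^sub>R adjoint A (snd d))"
      unfolding J_def by (rule norm_triangle_ineq4)
    also have "\<dots> \<le> norm d + \<rho> * (L * norm d)"
      using n L(1) L(2)[of "snd d"] \<rho> by (simp add: add_mono) (meson mult_left_mono order_trans less_imp_le add_mono)
    finally have "norm (J d) \<le> (1 + \<rho> * L) * norm d" by (simp add: algebra_simps)
    then show ?thesis unfolding N_def power_mult_distrib[symmetric] by (intro power_mono) auto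
  qed
  \<comment> \<open>In \<open>c2\<close> the two summands bound the primal and the dual part of
    \<open>z' - w\<close>; \<open>c3\<close> collects the sizes of the residuals
    \<open>- d /\<^sub>R \<rho>\<close> and \<open>- A d\<close>.\<close>
  define c2 where "c2 = 1 + (G / \<rho>)\<^sup>2"
  define c3 where "c3 = (M * (1 / \<rho> + a))\<^sup>2"
  show ?thesis
  proof (rule fejer_linear_convergence[where N = N and p = "(xs, ys)" and R = R and \<alpha> = "(1 + \<rho> * L)\<^sup>2" and \<beta> = c2 and \<gamma> = c3])
    have "0 < 1 + \<rho> * L" "0 < 1 / \<rho> + a" using \<rho> L a by (simp_all add: add_pos_pos)
    then show "0 < (1 + \<rho> * L)\<^sup>2" "0 < c2" "0 < c3"
      using R by (simp_all add: c2_def c3_def add_pos_nonneg)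
    fix z z' assume T: "admm_step \<rho> z z'"
    define d where "d = J (z' - z)"
    have kkt: "kkt_residual (fst z') (snd z') (- d /\<^sub>R \<rho>) (- A d)"
      using T by (simp add: admm_step_def d_def J_def Let_def case_prod_beta del: minus_diff_eq)
    show "N (z' - w) + N (z' - z) \<le> N (z - w)" if w: "w \<in> Z" for w
    proof -
      have "d \<bullet> (fst z' - fst w) / \<rho> \<le> d \<bullet> adjoint A (snd z' - snd w)"
        using kkt_residual_monotone[OF kkt w] by (simp add: adj inner_commute divide_inverse mult.commute)
      then have "d \<bullet> J (z' - w) \<le> 0"
        using \<rho> by (simp add: J_def inner_diff_right pos_divide_le_eq mult.commute)
      moreover have "z - w = (z' - w) - (z' - z)" by simp
      ultimately show ?thesis
        unfolding N_def by (metis (no_types, lifting) Jdiff d_def power2_norm_diff_ge)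
    qed
    show "(norm (z' - w))\<^sup>2 \<le> c2 * N (z - w)" if w: "w \<in> Z" for w
    proof -
      define s where "s = c + adjoint A (snd z') + d /\<^sub>R \<rho>"
      define X U S where "X = fst z' - fst w" and "U = snd z' - snd w"
        and "S = s - (c + adjoint A (snd w))"
      let ?m = "J (z - w)"
      have z': "fst z' \<in> K" "s \<in> dual_cone K" "s \<bullet> fst z' = 0" "A (fst z') - b = - A d"
        using kkt by (auto simp: kkt_residual_def s_def)
      have w': "fst w \<in> K" "A (fst w) = b" "c + adjoint A (snd w) \<in> dual_cone K"
        "fst w \<bullet> (c + adjoint A (snd w)) = 0"
        using ZD[of "fst w" "snd w"] w by auto
      have XS: "X \<bullet> S \<le> 0"
      proof -
        have "0 \<le> s \<bullet> fst w" "0 \<le> (c + adjoint A (snd w)) \<bullet> fst z'"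
          using z' w' by (auto simp: dual_cone_def)
        then show ?thesis using z'(3) w'(4) unfolding X_def S_def
          by (simp only: inner_diff_left inner_diff_right inner_commute)
      qed
      have d: "d = X - \<rho> *\<^sub>R adjoint A U - ?m"
        by (simp add: d_def J_def X_def U_def linear_diff[OF lin_At] algebra_simps)
      have S: "\<rho> *\<^sub>R S = \<rho> *\<^sub>R adjoint A U + d"
        using \<rho> by (simp add: S_def s_def U_def linear_diff[OF lin_At] algebra_simps)
      \<comment> \<open>Differences of points and slacks have nonpositive product, so both
        \<open>X\<close> and \<open>X + \<rho> *\<^sub>R S\<close> are no longer than
        \<open>X - \<rho> *\<^sub>R S\<close>, which is \<open>J (z - w)\<close>.\<close>
      have m: "?m = X - \<rho> *\<^sub>R S" using d S by simp
      have "A X = - A d" using z'(4) w'(2) by (simp add: X_def linear_diff[OF lin_A])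
      \<comment> \<open>The relation says that \<open>\<rho> *\<^sub>R adjoint A U\<close> is the
        orthogonal projection of \<open>X + \<rho> *\<^sub>R S\<close> to the range of the adjoint,
        hence no longer than it.\<close>
      then have "A (X + \<rho> *\<^sub>R S) = A (\<rho> *\<^sub>R adjoint A U)"
        unfolding S by (simp add: linear_add[OF lin_A])
      then have "(X + \<rho> *\<^sub>R S) \<bullet> adjoint A U = \<rho> * (norm (adjoint A U))\<^sup>2"
        by (simp add: adj power2_norm_eq_inner linear_cmul[OF lin_A])
      then have "\<rho> * norm (adjoint A U) * norm (adjoint A U) \<le> norm (X + \<rho> *\<^sub>R S) * norm (adjoint A U)"
        using norm_cauchy_schwarz[of "X + \<rho> *\<^sub>R S" "adjoint A U"] by (simp add: power2_eq_square)
      then have AU: "\<rho> * norm (adjoint A U) \<le> norm (X + \<rho> *\<^sub>R S)"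
        by (cases "adjoint A U = 0") auto
      have XS': "X \<bullet> (\<rho> *\<^sub>R S) \<le> 0" using XS \<rho> by (simp add: mult_nonneg_nonpos)
      have m2: "(norm ?m)\<^sup>2 = (norm X)\<^sup>2 - 2 * (X \<bullet> (\<rho> *\<^sub>R S)) + (norm (\<rho> *\<^sub>R S))\<^sup>2"
        unfolding m using power2_norm_add[of X "- (\<rho> *\<^sub>R S)"] by simp
      then have Xm: "(norm X)\<^sup>2 \<le> (norm ?m)\<^sup>2" and Xm': "(norm (X + \<rho> *\<^sub>R S))\<^sup>2 \<le> (norm ?m)\<^sup>2"
        using XS' power2_norm_add[of X "\<rho> *\<^sub>R S"] zero_le_power2[of "norm (\<rho> *\<^sub>R S)"] by linarith+
      have "norm (X + \<rho> *\<^sub>R S) \<le> norm ?m" using Xm' by (rule power2_le_imp_le) simp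
      then have "norm (adjoint A U) \<le> norm ?m / \<rho>"
        using AU \<rho> by (simp add: pos_le_divide_eq mult.commute)
      then have "norm U \<le> G * (norm ?m / \<rho>)"
        using G(2)[of U] G(1) by (meson mult_left_mono order_trans less_imp_le)
      then have "(norm U)\<^sup>2 \<le> (G / \<rho> * norm ?m)\<^sup>2" by (intro power_mono) auto
      moreover have "(norm (z' - w))\<^sup>2 = (norm X)\<^sup>2 + (norm U)\<^sup>2"
        by (cases z'; cases w) (simp add: X_def U_def norm_Pair)
      ultimately have "(norm (z' - w))\<^sup>2 \<le> (norm ?m)\<^sup>2 + (G / \<rho> * norm ?m)\<^sup>2"
        using Xm by linarith
      also have "\<dots> = c2 * N (z - w)"
        unfolding c2_def N_def power_mult_distrib by (simp only: distrib_right mult_1)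
      finally show ?thesis .
    qed
    show "(infdist z' Z)\<^sup>2 \<le> c3 * N (z' - z)" if near: "dist z' (xs, ys) \<le> R"
    proof -
      have "norm (- d /\<^sub>R \<rho>) + norm (- A d) \<le> norm d / \<rho> + a * norm d"
        using a(2)[of d] \<rho> by (simp add: divide_inverse mult.commute)
      then have "M * (norm (- d /\<^sub>R \<rho>) + norm (- A d)) \<le> M * (norm d / \<rho> + a * norm d)"
        using R by (intro mult_left_mono) auto
      then have "infdist z' Z \<le> M * (1 / \<rho> + a) * norm d"
        using eb[OF kkt near] by (simp add: algebra_simps)
      then have "(infdist z' Z)\<^sup>2 \<le> (M * (1 / \<rho> + a) * norm d)\<^sup>2" by (intro power_mono infdist_nonneg)
      then show ?thesis by (simp add: c3_def N_def d_def power_mult_distrib)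
    qed
  qed (use pair_in_Z R Nup in \<open>auto simp: N_def\<close>)
qed

end

theorem mainTheorem1:
  fixes K :: "'e::euclidean_space set"
    and A :: "'e \<Rightarrow> 'f::euclidean_space"
    and b :: 'f and c :: 'e
    and xs0 :: 'e and ys0 :: 'f
  assumes "closed K" and "convex_cone K"
    and "linear A" and "surj A"
    and "strictly_complementary_pair K A b c xs0 ys0"
    and "quadratic_facial_violation K (c + adjoint A ys0)"
    and "quadratic_facial_violation (dual_cone K) xs0"
  shows "(\<forall>\<eta>. 0 < \<eta> \<and> \<eta> < 1 / onorm A \<longrightarrow>
            (\<exists>r>0. \<exists>r'>0. \<exists>q. 0 < q \<and> q < 1 \<and>
              (\<forall>x y. pdhg_iterates K A b c \<eta> x y \<and> (x 0, y 0) \<in> cball (xs0, ys0) r \<longrightarrow>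
                (\<forall>k. infdist (x k, y k) (primal_solutions K A b c \<times> dual_solutions K A b c)
                       \<le> q ^ k * r'))))
       \<and> (\<forall>\<rho>>0.
            (\<exists>r>0. \<exists>r'>0. \<exists>q. 0 < q \<and> q < 1 \<and>
              (\<forall>v x y. admm_iterates K A b c \<rho> v x y \<and> (x 0, y 0) \<in> cball (xs0, ys0) r \<longrightarrow>
                (\<forall>k. infdist (x k, y k) (primal_solutions K A b c \<times> dual_solutions K A b c)
                       \<le> q ^ k * r'))))"
proof -
  interpret facially_regular_conic_program K A b c xs0 ys0
    by (intro facially_regular_conic_program.intro complementary_conic_program.intro
        facially_regular_conic_program_axioms.intro assms)
  let ?P = "\<lambda>r r' q. 0 < (r::real) \<and> 0 < (r'::real) \<and> 0 < (q::real) \<and> q < 1"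
  have pdhg: "\<exists>r>0. \<exists>r'>0. \<exists>q. 0 < q \<and> q < 1 \<and>
      (\<forall>x y. pdhg_iterates K A b c \<eta> x y \<and> (x 0, y 0) \<in> cball (xs0, ys0) r \<longrightarrow>
        (\<forall>k. infdist (x k, y k) Z \<le> q ^ k * r'))" if \<eta>: "0 < \<eta>" "\<eta> < 1 / onorm A" for \<eta>
  proof -
    \<comment> \<open>The constants are fixed before the sequence, so they hold for all starting
      points in the ball.\<close>
    obtain r r' q where *: "?P r r' q" and conv: "\<And>z. \<forall>k. pdhg_step \<eta> (z k) (z (Suc k)) \<Longrightarrow>
        z 0 \<in> cball (xs0, ys0) r \<Longrightarrow> \<forall>k. infdist (z k) Z \<le> q ^ k * r'"
      using pdhg_linear_convergence[OF \<eta>] by metis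
    have "\<forall>k. infdist (x k, y k) Z \<le> q ^ k * r'"
      if "pdhg_iterates K A b c \<eta> x y" "(x 0, y 0) \<in> cball (xs0, ys0) r" for x y
      using conv[of "\<lambda>k. (x k, y k)"] pdhg_iterates_step[OF that(1) \<eta>(1)] that(2) by simp
    with * show ?thesis by blast
  qed
  have admm: "\<exists>r>0. \<exists>r'>0. \<exists>q. 0 < q \<and> q < 1 \<and>
      (\<forall>v x y. admm_iterates K A b c \<rho> v x y \<and> (x 0, y 0) \<in> cball (xs0, ys0) r \<longrightarrow>
        (\<forall>k. infdist (x k, y k) Z \<le> q ^ k * r'))" if \<rho>: "0 < \<rho>" for \<rho>
  proof -
    obtain r r' q where *: "?P r r' q" and conv: "\<And>z. \<forall>k. admm_step \<rho> (z k) (z (Suc k)) \<Longrightarrow>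
        z 0 \<in> cball (xs0, ys0) r \<Longrightarrow> \<forall>k. infdist (z k) Z \<le> q ^ k * r'"
      using admm_linear_convergence[OF \<rho>] by metis
    have "\<forall>k. infdist (x k, y k) Z \<le> q ^ k * r'"
      if "admm_iterates K A b c \<rho> v x y" "(x 0, y 0) \<in> cball (xs0, ys0) r" for v x y
      using conv[of "\<lambda>k. (x k, y k)"] admm_iterates_step[OF that(1) \<rho>] that(2) by simp
    with * show ?thesis by blast
  qed
  show ?thesis
    using pdhg admm unfolding Z_def by simp
qed

end
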